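(* Let $X$ be an infinite-dimensional complex Banach space and let $T\in\mathcal{B}(X)$ be an upper (resp., lower, essentially upper, essentially lower) Drazin invertible operator. Then the following conditions are equivalent: (i) $T$ is left (resp., right, essentially left, essentially right) Drazin invertible. (ii) $T$ is of Saphar type. (iii) $T$ admits a generalized Saphar decomposition. (iv) $T$ admits a generalized Saphar-meromorphic decomposition. (Thus there are four assertions, one for each of the pairs upper/left, lower/right, essentially upper/essentially left, essentially lower/essentially right.)
   Context: $\mathcal{B}(X)$ is the algebra of bounded linear operators on $X$; $\mathcal{N}(T)$, $\mathcal{R}(T)$ denote kernel and range; $\mathbb{N}_0=\{0,1,2,\dots\}$, $\mathbb{N}=\{1,2,\dots\}$; the infimum of the empty set is $\infty$. A subspace of a Banach space is topologically complemented if it is closed and has a closed algebraic complement. For $T\in\mathcal{B}(X)$: the ascent $a(T)$ (resp. descent $d(T)$) is the smallest $n\in\mathbb{N}_0$ with $\mathcal{N}(T^n)=\mathcal{N}(T^{n+1})$ (resp. $\mathcal{R}(T^n)=\mathcal{R}(T^{n+1})$). The essential ascent $a_e(T)$ (resp. essential descent $d_e(T)$) is the smallest $n\in\mathbb{N}_0$ with $\dim(\mathcal{N}(T)\cap\mathcal{R}(T^n))<\infty$ (resp. $\operatorname{codim}(\mathcal{R}(T)+\mathcal{N}(T^n))<\infty$). The degree of stable iteration is $\operatorname{dis}(T)=\inf\{n\in\mathbb{N}_0: m\ge n,\ m\in\mathbb{N}\Rightarrow \mathcal{N}(T)\cap\mathcal{R}(T^n)=\mathcal{N}(T)\cap\mathcal{R}(T^m)\}$.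 (All of these may be $\infty$.) $T$ is upper Drazin invertible if $a(T)<\infty$ and $\mathcal{R}(T^n)$ is closed for every $n\ge a(T)$; lower Drazin invertible if $d(T)<\infty$ and $\mathcal{R}(T^n)$ is closed for every $n\ge d(T)$; essentially upper Drazin invertible if $a_e(T)<\infty$ and $\mathcal{R}(T^n)$ is closed for every $n\ge a_e(T)$; essentially lower Drazin invertible if $d_e(T)<\infty$ and $\mathcal{R}(T^n)$ is closed for every $n\ge d_e(T)$. $T$ is left Drazin invertible if $p:=a(T)<\infty$ and $\mathcal{R}(T)+\mathcal{N}(T^p)$ is topologically complemented; right Drazin invertible if $q:=d(T)<\infty$ and $\mathcal{N}(T)\cap\mathcal{R}(T^q)$ is topologically complemented; essentially left Drazin invertible if $a_e(T)<\infty$ and $\mathcal{R}(T)+\mathcal{N}(T^{\operatorname{dis}(T)})$ is topologically complemented; essentially right Drazin invertible if $d_e(T)<\infty$ and $\mathcal{N}(T)\cap\mathcal{R}(T^{\operatorname{dis}(T)})$ is topologically complemented. $(M,N)\in Red(T)$ means that $M,N$ are closed $T$-invariant subspaces of $X$ with $X=M\oplus N$; then $T_M,T_N$ denote the restrictions of $T$ to $M$, $N$, viewed as operators on $M$, $N$. An operator is Kato if its range is closed and its kernel is contained in the range of each of its powers; relatively regular if its kernel and range are topologically complemented; Saphar if it is Kato and relatively regular. An operator is meromorphic if every non-zero point of its spectrum is a pole of its resolvent. $T$ is of Saphar type if there is $(M,N)\in Red(T)$ with $T_M$ Saphar and $T_N$ nilpotent; $T$ admits a generalized Saphar decomposition if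 there is $(M,N)\in Red(T)$ with $T_M$ Saphar and $T_N$ quasinilpotent; $T$ admits a generalized Saphar-meromorphic decomposition if there is $(M,N)\in Red(T)$ with $T_M$ Saphar and $T_N$ meromorphic. *)

theory Defs
  imports "HOL-Analysis.Analysis"
begin

class complex_banach = banach +
  fixes scaleC :: "complex \<Rightarrow> 'a \<Rightarrow> 'a" (infixr "*\<^sub>C" 75)
  assumes scaleC_add_right: "c *\<^sub>C (x + y) = c *\<^sub>C x + c *\<^sub>C y"
    and scaleC_add_left: "(c + d) *\<^sub>C x = c *\<^sub>C x + d *\<^sub>C x"
    and scaleC_scaleC: "c *\<^sub>C d *\<^sub>C x = (c * d) *\<^sub>C x"
    and scaleC_of_real: "complex_of_real r *\<^sub>C x = r *\<^sub>R x"
    and norm_scaleC: "norm (c *\<^sub>C x) = cmod c * norm x"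

global_interpretation complex_vector:
  vector_space "scaleC :: complex \<Rightarrow> 'a \<Rightarrow> 'a::complex_banach"
proof
  show "1 *\<^sub>C x = x" for x :: 'a
    using scaleC_of_real[of 1 x] by simp
qed (simp_all add: scaleC_add_right scaleC_add_left scaleC_scaleC)

definition closed_csubspace :: "'a::complex_banach set \<Rightarrow> bool" where
  "closed_csubspace M \<longleftrightarrow> complex_vector.subspace M \<and> closed M"

definition finite_cdim :: "'a::complex_banach set \<Rightarrow> bool" where
  "finite_cdim V \<longleftrightarrow> (\<exists>B. finite B \<and> complex_vector.span B = V)"

text \<open>The codimension of a subspace \<open>L\<close> is the dimension of the quotient by \<open>L\<close>; it is finite iff
  the cosets of finitely many vectors span that quotient.\<close>

definition finite_ccodim :: "'a::complex_banach set \<Rightarrow> bool" where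
  "finite_ccodim L \<longleftrightarrow> (\<exists>B. finite B \<and> L + complex_vector.span B = UNIV)"

definition direct_sum :: "'a::complex_banach set \<Rightarrow> 'a set \<Rightarrow> 'a set \<Rightarrow> bool" where
  "direct_sum X M N \<longleftrightarrow> complex_vector.subspace M \<and> complex_vector.subspace N \<and>
     M \<inter> N = {0} \<and> M + N = X"

text \<open>The restriction of an operator \<open>T\<close> to a closed invariant subspace \<open>M\<close>, viewed as an
  operator on the Banach space \<open>M\<close>, is represented by the pair of \<open>M\<close> and \<open>T\<close>: a notion for
  operators on \<open>M\<close> takes the carrier \<open>M\<close> as a parameter and depends only on the values of \<open>T\<close>
  on \<open>M\<close>. The carrier of the ambient Banach space is \<open>UNIV\<close>.\<close>

definition top_complemented_in :: "'a::complex_banach set \<Rightarrow> 'a set \<Rightarrow> bool" where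
  "top_complemented_in M L \<longleftrightarrow> closed_csubspace L \<and> (\<exists>W. closed_csubspace W \<and> direct_sum M L W)"

definition bounded_op_on :: "'a::complex_banach set \<Rightarrow> ('a \<Rightarrow> 'a) \<Rightarrow> bool" where
  "bounded_op_on M T \<longleftrightarrow> T ` M \<subseteq> M \<and>
     (\<forall>x\<in>M. \<forall>y\<in>M. T (x + y) = T x + T y) \<and>
     (\<forall>c. \<forall>x\<in>M. T (c *\<^sub>C x) = c *\<^sub>C T x) \<and>
     (\<exists>K. \<forall>x\<in>M. norm (T x) \<le> norm x * K)"

lemma bounded_op_on_UNIV:
  "bounded_op_on UNIV T \<longleftrightarrow> bounded_linear T \<and> (\<forall>c x. T (c *\<^sub>C x) = c *\<^sub>C T x)"
proof
  assume T: "bounded_op_on UNIV T"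
  then have "T (r *\<^sub>R x) = r *\<^sub>R T x" for r x
    by (metis UNIV_I bounded_op_on_def scaleC_of_real)
  moreover have "T (x + y) = T x + T y" for x y
    using T by (simp add: bounded_op_on_def)
  moreover obtain K where "norm (T x) \<le> norm x * K" for x
    using T by (auto simp: bounded_op_on_def)
  ultimately have "bounded_linear T"
    by (intro bounded_linear_intro)
  with T show "bounded_linear T \<and> (\<forall>c x. T (c *\<^sub>C x) = c *\<^sub>C T x)"
    by (simp add: bounded_op_on_def)
next
  assume "bounded_linear T \<and> (\<forall>c x. T (c *\<^sub>C x) = c *\<^sub>C T x)"
  then show "bounded_op_on UNIV T"
    unfolding bounded_op_on_def
    by (auto simp: bounded_linear_def bounded_linear_axioms_def linear_add)
qed

definition ker_on :: "'a::complex_banach set \<Rightarrow> ('a \<Rightarrow> 'a) \<Rightarrow> 'a set" where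
  "ker_on M T = {x \<in> M. T x = 0}"

abbreviation ker :: "('a::complex_banach \<Rightarrow> 'a) \<Rightarrow> 'a set" where
  "ker T \<equiv> ker_on UNIV T"

text \<open>In \<^typ>\<open>enat\<close> the infimum of the empty set is \<open>\<infinity>\<close>.\<close>

definition ascent :: "('a::complex_banach \<Rightarrow> 'a) \<Rightarrow> enat" where
  "ascent T = Inf (enat ` {n. ker (T ^^ n) = ker (T ^^ (n + 1))})"

definition descent :: "('a::complex_banach \<Rightarrow> 'a) \<Rightarrow> enat" where
  "descent T = Inf (enat ` {n. range (T ^^ n) = range (T ^^ (n + 1))})"

definition ess_ascent :: "('a::complex_banach \<Rightarrow> 'a) \<Rightarrow> enat" where
  "ess_ascent T = Inf (enat ` {n. finite_cdim (ker T \<inter> range (T ^^ n))})"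

definition ess_descent :: "('a::complex_banach \<Rightarrow> 'a) \<Rightarrow> enat" where
  "ess_descent T = Inf (enat ` {n. finite_ccodim (range T + ker (T ^^ n))})"

definition dis :: "('a::complex_banach \<Rightarrow> 'a) \<Rightarrow> enat" where
  "dis T = Inf (enat ` {n. \<forall>m\<ge>n. m \<ge> 1 \<longrightarrow> ker T \<inter> range (T ^^ n) = ker T \<inter> range (T ^^ m)})"

definition upper_Drazin :: "('a::complex_banach \<Rightarrow> 'a) \<Rightarrow> bool" where
  "upper_Drazin T \<longleftrightarrow> ascent T < \<infinity> \<and> (\<forall>n. enat n \<ge> ascent T \<longrightarrow> closed (range (T ^^ n)))"

definition lower_Drazin :: "('a::complex_banach \<Rightarrow> 'a) \<Rightarrow> bool" where
  "lower_Drazin T \<longleftrightarrow> descent T < \<infinity> \<and> (\<forall>n. enat n \<ge> descent T \<longrightarrow> closed (range (T ^^ n)))"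

definition ess_upper_Drazin :: "('a::complex_banach \<Rightarrow> 'a) \<Rightarrow> bool" where
  "ess_upper_Drazin T \<longleftrightarrow>
     ess_ascent T < \<infinity> \<and> (\<forall>n. enat n \<ge> ess_ascent T \<longrightarrow> closed (range (T ^^ n)))"

definition ess_lower_Drazin :: "('a::complex_banach \<Rightarrow> 'a) \<Rightarrow> bool" where
  "ess_lower_Drazin T \<longleftrightarrow>
     ess_descent T < \<infinity> \<and> (\<forall>n. enat n \<ge> ess_descent T \<longrightarrow> closed (range (T ^^ n)))"

definition left_Drazin :: "('a::complex_banach \<Rightarrow> 'a) \<Rightarrow> bool" where
  "left_Drazin T \<longleftrightarrow>
     (\<exists>p. ascent T = enat p \<and> top_complemented_in UNIV (range T + ker (T ^^ p)))"

definition right_Drazin :: "('a::complex_banach \<Rightarrow> 'a) \<Rightarrow> bool" where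
  "right_Drazin T \<longleftrightarrow>
     (\<exists>q. descent T = enat q \<and> top_complemented_in UNIV (ker T \<inter> range (T ^^ q)))"

text \<open>If the essential ascent or the essential descent of \<open>T\<close> is finite, then so is \<open>dis T\<close>, so
  \<open>dis T = enat d\<close> below only names its value.\<close>

definition ess_left_Drazin :: "('a::complex_banach \<Rightarrow> 'a) \<Rightarrow> bool" where
  "ess_left_Drazin T \<longleftrightarrow> ess_ascent T < \<infinity> \<and>
     (\<exists>d. dis T = enat d \<and> top_complemented_in UNIV (range T + ker (T ^^ d)))"

definition ess_right_Drazin :: "('a::complex_banach \<Rightarrow> 'a) \<Rightarrow> bool" where
  "ess_right_Drazin T \<longleftrightarrow> ess_descent T < \<infinity> \<and>
     (\<exists>d. dis T = enat d \<and> top_complemented_in UNIV (ker T \<inter> range (T ^^ d)))"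

definition invertible_on :: "'a::complex_banach set \<Rightarrow> ('a \<Rightarrow> 'a) \<Rightarrow> bool" where
  "invertible_on M T \<longleftrightarrow>
     (\<exists>S. bounded_op_on M S \<and> (\<forall>x\<in>M. S (T x) = x) \<and> (\<forall>x\<in>M. T (S x) = x))"

definition spectrum_on :: "'a::complex_banach set \<Rightarrow> ('a \<Rightarrow> 'a) \<Rightarrow> complex set" where
  "spectrum_on M T = {z. \<not> invertible_on M (\<lambda>x. z *\<^sub>C x - T x)}"

text \<open>Only meaningful off the spectrum, and on \<open>M\<close>.\<close>

definition resolvent_on :: "'a::complex_banach set \<Rightarrow> ('a \<Rightarrow> 'a) \<Rightarrow> complex \<Rightarrow> 'a \<Rightarrow> 'a" where
  "resolvent_on M T z = inv_into M (\<lambda>x. z *\<^sub>C x - T x)"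

text \<open>The point \<open>w\<close> is a pole if, in a punctured disc around \<open>w\<close> that is disjoint from the spectrum,
  the resolvent has a Laurent expansion in \<open>\<B>(M)\<close> whose first nonzero term is
  \<open>(z - w) powi (- p) *\<^sub>C A 0\<close> with \<open>p \<ge> 1\<close>. Uniform convergence on the unit ball of \<open>M\<close> is
  convergence in the operator norm. Divergence of the
  norm would not suffice, since the norm of the resolvent tends to infinity at every isolated point
  of the spectrum, including essential singularities.\<close>

definition resolvent_pole_on :: "'a::complex_banach set \<Rightarrow> ('a \<Rightarrow> 'a) \<Rightarrow> complex \<Rightarrow> bool" where
  "resolvent_pole_on M T w \<longleftrightarrow>
     (\<exists>r>0. \<exists>p::nat\<ge>1. \<exists>A :: nat \<Rightarrow> 'a \<Rightarrow> 'a.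
        (\<forall>k. bounded_op_on M (A k)) \<and> (\<exists>x\<in>M. A 0 x \<noteq> 0) \<and>
        (\<forall>z. 0 < cmod (z - w) \<and> cmod (z - w) < r \<longrightarrow>
           z \<notin> spectrum_on M T \<and>
           uniform_limit {x \<in> M. norm x \<le> 1}
             (\<lambda>n x. \<Sum>k<n. ((z - w) powi (int k - int p)) *\<^sub>C A k x)
             (resolvent_on M T z) sequentially))"

definition meromorphic_op_on :: "'a::complex_banach set \<Rightarrow> ('a \<Rightarrow> 'a) \<Rightarrow> bool" where
  "meromorphic_op_on M T \<longleftrightarrow> (\<forall>w\<in>spectrum_on M T. w \<noteq> 0 \<longrightarrow> resolvent_pole_on M T w)"

text \<open>Inclusion rather than equality: the spectrum of the operator on the zero space is empty, and
  that operator counts as quasinilpotent.\<close>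

definition quasinilpotent_on :: "'a::complex_banach set \<Rightarrow> ('a \<Rightarrow> 'a) \<Rightarrow> bool" where
  "quasinilpotent_on M T \<longleftrightarrow> spectrum_on M T \<subseteq> {0}"

definition nilpotent_on :: "'a::complex_banach set \<Rightarrow> ('a \<Rightarrow> 'a) \<Rightarrow> bool" where
  "nilpotent_on M T \<longleftrightarrow> (\<exists>n. \<forall>x\<in>M. (T ^^ n) x = 0)"

definition Kato_on :: "'a::complex_banach set \<Rightarrow> ('a \<Rightarrow> 'a) \<Rightarrow> bool" where
  "Kato_on M T \<longleftrightarrow> closed (T ` M) \<and> (\<forall>n. ker_on M T \<subseteq> (T ^^ n) ` M)"

definition relatively_regular_on :: "'a::complex_banach set \<Rightarrow> ('a \<Rightarrow> 'a) \<Rightarrow> bool" where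
  "relatively_regular_on M T \<longleftrightarrow>
     top_complemented_in M (ker_on M T) \<and> top_complemented_in M (T ` M)"

definition Saphar_on :: "'a::complex_banach set \<Rightarrow> ('a \<Rightarrow> 'a) \<Rightarrow> bool" where
  "Saphar_on M T \<longleftrightarrow> Kato_on M T \<and> relatively_regular_on M T"

definition Red :: "('a::complex_banach \<Rightarrow> 'a) \<Rightarrow> ('a set \<times> 'a set) set" where
  "Red T = {(M, N). closed_csubspace M \<and> closed_csubspace N \<and>
     T ` M \<subseteq> M \<and> T ` N \<subseteq> N \<and> direct_sum UNIV M N}"

definition Saphar_type :: "('a::complex_banach \<Rightarrow> 'a) \<Rightarrow> bool" where
  "Saphar_type T \<longleftrightarrow> (\<exists>(M, N)\<in>Red T. Saphar_on M T \<and> nilpotent_on N T)"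

definition generalized_Saphar :: "('a::complex_banach \<Rightarrow> 'a) \<Rightarrow> bool" where
  "generalized_Saphar T \<longleftrightarrow> (\<exists>(M, N)\<in>Red T. Saphar_on M T \<and> quasinilpotent_on N T)"

definition generalized_Saphar_meromorphic :: "('a::complex_banach \<Rightarrow> 'a) \<Rightarrow> bool" where
  "generalized_Saphar_meromorphic T \<longleftrightarrow>
     (\<exists>(M, N)\<in>Red T. Saphar_on M T \<and> meromorphic_op_on N T)"

end

theory Submission
  imports Defs
begin

text \<open>All four assertions are instances of one theorem. Let \<open>d\<close> be such that \<open>ker T \<inter> range (T ^^ m)\<close> is
  the same subspace \<open>K\<close> for all \<open>m \<ge> d\<close>, and let \<open>range (T ^^ m)\<close> be closed for these \<open>m\<close>. Put
  \<open>S = range T + ker (T ^^ d)\<close>, which is the preimage of \<open>range (T ^^ Suc d)\<close> under \<open>T ^^ d\<close> and hence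
  closed. Then \<open>T\<close> is of Saphar type iff both \<open>K\<close> and \<open>S\<close> are complemented, and iff it admits a
  generalized Saphar or Saphar-meromorphic decomposition (\<open>Saphar_equivalences\<close>). For an upper
  (lower) Drazin invertible operator \<open>d\<close> is the ascent (descent), for an essentially upper or lower
  Drazin invertible one it is the degree of stable iteration. In each case one of the two complements
  exists automatically, since \<open>K\<close> is finite-dimensional or \<open>S\<close> is closed of finite codimension, and
  the other one is what left or right Drazin invertibility in the respective sense demands.

  The construction of the decomposition (\<open>Saphar_type_of_complemented\<close>) is explicit. Let \<open>L\<close> be a
  complement of \<open>S\<close> and \<open>W\<close> a complement of \<open>K\<close>. The Saphar part is
  \<open>M = L + T L + \<dots> + T\<^sup>d\<^sup>-\<^sup>1 L + range (T ^^ d)\<close>, and the nilpotent part \<open>N\<close> consists of the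
  \<open>x \<in> ker (T ^^ d)\<close> for which all \<open>(T ^^ k) x\<close> with \<open>k < d\<close> lie in \<open>W\<close>. Both are invariant under \<open>T\<close>,
  the kernel of \<open>T\<close> on \<open>M\<close> is \<open>K\<close>, and \<open>T ` M = M \<inter> S\<close>. That \<open>M\<close> is closed is the analytic point,
  and rests on the open mapping theorem for \<open>T ^^ d\<close>. Conversely, in a decomposition of Saphar type
  \<open>K\<close> is the kernel of \<open>T\<close> on \<open>M\<close> and \<open>S = T ` M + N\<close> (\<open>complemented_of_Saphar_type\<close>).

  Finally let \<open>T\<close> be Saphar on \<open>M\<close> and meromorphic on \<open>N\<close>. Arbitrarily close to \<open>0\<close> there are points
  \<open>z\<close> for which \<open>z - T\<close> is invertible on \<open>N\<close>, and hence on \<open>Y = (T ^^ d) ` N\<close>. On \<open>Y\<close> the operator \<open>T\<close>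
  is Kato, and a Kato operator with this property is bijective. So \<open>N\<close> is the direct sum of \<open>Y\<close> and
  \<open>N \<inter> ker (T ^^ d)\<close>, and \<open>T\<close> is of Saphar type with the parts \<open>M + Y\<close> and \<open>N \<inter> ker (T ^^ d)\<close>
  (\<open>Saphar_type_of_meromorphic\<close>).\<close>

section \<open>The open mapping theorem\<close>

text \<open>The open mapping theorem for the restriction of a bounded operator to a closed subspace \<open>E\<close>, in
  the quantitative form in which it is used below. By Baire's theorem in the complete space \<open>f ` E\<close>,
  the closure of the image of some ball of \<open>E\<close> has an interior point; by symmetry and scaling every
  \<open>y\<close> in the image is then approximated up to half its norm by the image of a vector of comparable
  norm, and summing the successive corrections gives an exact preimage.\<close>

lemma open_mapping_bound:
  fixes f :: "'b::banach \<Rightarrow> 'a::banach"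
  assumes f: "bounded_linear f" and E: "subspace E" "closed E" and F: "closed (f ` E)"
  obtains C where "C > 0" "\<And>y. y \<in> f ` E \<Longrightarrow> \<exists>x\<in>E. f x = y \<and> norm x \<le> C * norm y"
proof -
  interpret bounded_linear f by fact
  define G where "G n = closure (f ` (E \<inter> cball 0 (real n)))" for n
  have subF: "subspace (f ` E)"
    using E(1) linear_axioms by (rule linear_subspace_image[rotated])
  have GF: "G n \<subseteq> f ` E" for n
    unfolding G_def using F by (intro closure_minimal) auto
  have cover: "(\<Union>n. G n) = f ` E"
  proof
    show "f ` E \<subseteq> (\<Union>n. G n)"
    proof
      fix y assume "y \<in> f ` E"
      then obtain x where x: "x \<in> E" "y = f x" by auto
      obtain n where "norm x \<le> real n" using real_arch_simple by blast
      then have "y \<in> G n" unfolding G_def using x by (intro subsetD[OF closure_subset]) auto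
      then show "y \<in> (\<Union>n. G n)" by auto
    qed
  qed (use GF in auto)
  have "\<exists>n. (top_of_set (f ` E)) interior_of (G n) \<noteq> {}"
  proof (rule ccontr)
    assume "\<not> ?thesis"
    then have none: "\<And>n. (top_of_set (f ` E)) interior_of (G n) = {}" by auto
    have "(top_of_set (f ` E)) interior_of \<Union>(range G) = {}"
    proof (rule Baire_category_alt)
      show "completely_metrizable_space (top_of_set (f ` E)) \<or>
          locally_compact_space (top_of_set (f ` E)) \<and> regular_space (top_of_set (f ` E))"
        using F closed_closedin completely_metrizable_space_closedin
          completely_metrizable_space_euclidean by blast
      fix A assume "A \<in> range G"
      then show "closedin (top_of_set (f ` E)) A \<and> top_of_set (f ` E) interior_of A = {}"
        using none GF closed_subset[of A "f ` E"] by (metis (mono_tags) G_def closed_closure imageE)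
    qed auto
    then have "(top_of_set (f ` E)) interior_of (f ` E) = {}" using cover by simp
    moreover have "(top_of_set (f ` E)) interior_of (f ` E) = f ` E"
      by (metis interior_of_topspace topspace_euclidean_subtopology)
    ultimately show False using subspace_0[OF subF] by auto
  qed
  then obtain n y0 where "y0 \<in> (top_of_set (f ` E)) interior_of (G n)" by auto
  then obtain U where U: "open U" "y0 \<in> U" "f ` E \<inter> U \<subseteq> G n" "y0 \<in> f ` E"
    unfolding interior_of_def openin_open by auto
  then obtain r where r: "r > 0" "ball y0 r \<subseteq> U" using openE by blast
  \<comment> \<open>Differences of two approximants move the ball around \<open>y0\<close> to the origin.\<close>
  have near: "\<exists>x\<in>E. norm x \<le> 2 * real n \<and> norm (y - f x) < e"
    if y: "y \<in> f ` E" "norm y < r" and e: "e > 0" for y e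
  proof -
    have "y0 + y \<in> f ` E \<inter> U"
      using y U r subspace_add[OF subF] by (auto simp: dist_norm intro!: subsetD[OF r(2)])
    then have "y0 + y \<in> G n" "y0 \<in> G n" using U by auto
    then obtain u v where uv: "u \<in> f ` (E \<inter> cball 0 (real n))" "dist u (y0 + y) < e/2"
      "v \<in> f ` (E \<inter> cball 0 (real n))" "dist v y0 < e/2"
      unfolding G_def closure_approachable using half_gt_zero[OF e] by blast
    then obtain x1 x2 where x: "x1 \<in> E" "norm x1 \<le> n" "dist (f x1) (y0 + y) < e/2"
      "x2 \<in> E" "norm x2 \<le> n" "dist (f x2) y0 < e/2"
      by auto
    have "norm (y - f (x1 - x2)) = norm ((f x2 - y0) - (f x1 - (y0 + y)))"
      by (simp add: diff algebra_simps)
    also have "\<dots> \<le> norm (f x2 - y0) + norm (f x1 - (y0 + y))" by (rule norm_triangle_ineq4)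
    also have "\<dots> < e" using x by (simp add: dist_norm)
    finally have "norm (y - f (x1 - x2)) < e" .
    moreover have "norm (x1 - x2) \<le> 2 * real n"
      using norm_triangle_ineq4[of x1 x2] x by linarith
    ultimately show ?thesis using subspace_diff[OF E(1)] x by blast
  qed
  define K where "K = 4 * real n / r"
  have K: "K \<ge> 0" unfolding K_def using r by simp
  have half: "\<exists>x\<in>E. norm x \<le> K * norm y \<and> norm (y - f x) \<le> norm y / 2"
    if y: "y \<in> f ` E" for y
  proof (cases "y = 0")
    case True
    then show ?thesis using subspace_0[OF E(1)] by (intro bexI[of _ 0]) (auto simp: zero)
  next
    case False
    define c where "c = r / (2 * norm y)"
    have c: "c > 0" unfolding c_def using r False by simp
    have "c *\<^sub>R y \<in> f ` E" using subspace_scale[OF subF y] .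
    moreover have "norm (c *\<^sub>R y) < r" using r False by (simp add: c_def)
    ultimately obtain x where x: "x \<in> E" "norm x \<le> 2 * real n" "norm (c *\<^sub>R y - f x) < r / 4"
      using near[of "c *\<^sub>R y" "r / 4"] r by auto
    have "norm (y - f (x /\<^sub>R c)) = norm (c *\<^sub>R y - f x) / c"
    proof -
      have "y - f (x /\<^sub>R c) = (c *\<^sub>R y - f x) /\<^sub>R c" using c by (simp add: scaleR algebra_simps)
      then show ?thesis using c by (simp add: divide_inverse_commute)
    qed
    also have "\<dots> \<le> (r / 4) / c" using x c by (intro divide_right_mono) auto
    also have "\<dots> = norm y / 2" using r False by (simp add: c_def)
    finally have 1: "norm (y - f (x /\<^sub>R c)) \<le> norm y / 2" .
    have "norm (x /\<^sub>R c) = norm x / c" using c by (simp add: divide_inverse_commute)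
    also have "\<dots> \<le> 2 * real n / c" using x c by (intro divide_right_mono) auto
    also have "\<dots> = K * norm y" using r False by (simp add: c_def K_def)
    finally have "norm (x /\<^sub>R c) \<le> K * norm y" .
    then show ?thesis using 1 subspace_scale[OF E(1) x(1)] by blast
  qed
  then have "\<forall>y\<in>f ` E. \<exists>x. x \<in> E \<and> norm x \<le> K * norm y \<and> norm (y - f x) \<le> norm y / 2" by blast
  from bchoice[OF this] obtain g where g: "\<And>y. y \<in> f ` E \<Longrightarrow> g y \<in> E"
    "\<And>y. y \<in> f ` E \<Longrightarrow> norm (g y) \<le> K * norm y"
    "\<And>y. y \<in> f ` E \<Longrightarrow> norm (y - f (g y)) \<le> norm y / 2"
    by blast
  show thesis
  proof
    show "2 * K + 1 > 0" using K by simp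
    fix y assume y: "y \<in> f ` E"
    \<comment> \<open>\<open>R k\<close> is the error that remains after \<open>k\<close> corrections.\<close>
    define R where "R k = ((\<lambda>z. z - f (g z)) ^^ k) y" for k
    have R0: "R 0 = y" and RS: "R (Suc k) = R k - f (g (R k))" for k by (simp_all add: R_def)
    have RF: "R k \<in> f ` E" for k
      by (induction k) (use y g subspace_diff[OF subF] in \<open>auto simp: R0 RS\<close>)
    have Rn: "norm (R k) \<le> norm y * (1/2) ^ k" for k
    proof (induction k)
      case (Suc k)
      then show ?case using g(3)[OF RF[of k]] by (simp add: RS)
    qed (simp add: R0)
    have bnd: "norm (g (R k)) \<le> (K * norm y) * (1/2) ^ k" for k
      using order.trans[OF g(2)[OF RF[of k]] mult_left_mono[OF Rn K]] by (simp add: mult.assoc)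
    have sg: "summable (\<lambda>k. (K * norm y) * (1/2::real) ^ k)"
      by (intro summable_mult summable_geometric) auto
    have sn: "summable (\<lambda>k. norm (g (R k)))"
      using bnd by (intro summable_comparison_test'[OF sg]) auto
    then have s: "summable (\<lambda>k. g (R k))" by (rule summable_norm_cancel)
    define x where "x = (\<Sum>k. g (R k))"
    have part: "(\<Sum>k<n. f (g (R k))) = y - R n" for n
      by (induction n) (simp_all add: R0 RS)
    have "(\<lambda>n. norm y * (1/2::real) ^ n) \<longlonglongrightarrow> norm y * 0"
      by (intro tendsto_intros LIMSEQ_power_zero) auto
    then have "R \<longlonglongrightarrow> 0"
      by (intro Lim_null_comparison[of R "\<lambda>n. norm y * (1/2) ^ n"] eventuallyI Rn) simp
    then have "(\<lambda>n. y - R n) \<longlonglongrightarrow> y - 0" by (intro tendsto_intros)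
    then have "(\<lambda>k. f (g (R k))) sums y" by (simp add: sums_def part)
    moreover have "(\<lambda>k. f (g (R k))) sums f x"
      unfolding x_def by (intro sums summable_sums s)
    ultimately have fx: "f x = y" by (rule sums_unique2[symmetric])
    have "norm x \<le> (\<Sum>k. norm (g (R k)))" unfolding x_def by (rule summable_norm[OF sn])
    also have "\<dots> \<le> (\<Sum>k. (K * norm y) * (1/2::real) ^ k)" by (intro suminf_le bnd sn sg)
    also have "\<dots> = 2 * K * norm y"
      by (subst suminf_mult) (auto simp: suminf_geometric)
    also have "\<dots> \<le> (2 * K + 1) * norm y" by (simp add: algebra_simps)
    finally have nx: "norm x \<le> (2 * K + 1) * norm y" .
    have "(\<lambda>n. \<Sum>k<n. g (R k)) \<longlonglongrightarrow> x"
      using s unfolding x_def by (rule summable_LIMSEQ)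
    moreover have "\<forall>n. (\<Sum>k<n. g (R k)) \<in> E"
      by (intro allI subspace_sum[OF E(1)] g(1) RF)
    ultimately have "x \<in> E" using closed_sequentially[OF E(2), of "\<lambda>n. \<Sum>k<n. g (R k)" x] by blast
    then show "\<exists>x\<in>E. f x = y \<and> norm x \<le> (2 * K + 1) * norm y" using fx nx by auto
  qed
qed

section \<open>Bounded operators and direct sums\<close>

lemma csubspace_imp_subspace:
  fixes S :: "'a::complex_banach set"
  shows "complex_vector.subspace S \<Longrightarrow> subspace S"
  unfolding complex_vector.subspace_def subspace_def
  by (metis scaleC_of_real)

locale bounded_operator =
  fixes T :: "'a::complex_banach \<Rightarrow> 'a"
  assumes bounded: "bounded_op_on UNIV T"
begin

lemma bl: "bounded_linear T" and scaleC: "T (c *\<^sub>C x) = c *\<^sub>C T x"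
  using bounded by (auto simp: bounded_op_on_UNIV)

sublocale bounded_linear T by (rule bl)

lemma subspace_vimage: "complex_vector.subspace S \<Longrightarrow> complex_vector.subspace (T -` S)"
  by (auto simp: complex_vector.subspace_def add scaleC zero)

lemma subspace_image: "complex_vector.subspace S \<Longrightarrow> complex_vector.subspace (T ` S)"
  unfolding complex_vector.subspace_def
  by (auto simp flip: add scaleC) (metis image_eqI zero)

lemma subspace_ker_on: "complex_vector.subspace S \<Longrightarrow> complex_vector.subspace (ker_on S T)"
  by (auto simp: complex_vector.subspace_def ker_on_def add scaleC zero)

lemma closed_vimage: "closed S \<Longrightarrow> closed (T -` S)"
  by (intro closed_vimage linear_continuous_on bl)

lemma closed_ker_on: "closed S \<Longrightarrow> closed (ker_on S T)"
proof -
  have "ker_on S T = S \<inter> T -` {0}" by (auto simp: ker_on_def)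
  then show "closed S \<Longrightarrow> closed (ker_on S T)" using closed_vimage[of "{0}"] by auto
qed

lemma power: "bounded_operator (T ^^ n)"
proof (induction n)
  case 0
  show ?case by unfold_locales (simp add: bounded_op_on_UNIV)
next
  case (Suc n)
  interpret P: bounded_operator "T ^^ n" by fact
  have "bounded_linear (\<lambda>x. T ((T ^^ n) x))" by (rule bounded_linear_compose[OF bl P.bl])
  then show ?case by unfold_locales (auto simp: bounded_op_on_UNIV scaleC P.scaleC comp_def)
qed

end

lemma csubspace_plus:
  "complex_vector.subspace A \<Longrightarrow> complex_vector.subspace B \<Longrightarrow> complex_vector.subspace (A + B)"
proof -
  have "A + B = {x + y |x y. x \<in> A \<and> y \<in> B}" by (auto simp: set_plus_def)
  then show "complex_vector.subspace A \<Longrightarrow> complex_vector.subspace B \<Longrightarrow> complex_vector.subspace (A + B)"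
    using complex_vector.subspace_sums[of A B] by simp
qed

text \<open>The projection is bounded because addition maps \<open>M \<times> N\<close> onto the whole space, so that the open
  mapping theorem bounds the components of \<open>x\<close> by the norm of \<open>x\<close>.\<close>

lemma direct_sum_projection:
  fixes M N :: "'a::complex_banach set"
  assumes M: "closed_csubspace M" and N: "closed_csubspace N" and ds: "direct_sum UNIV M N"
  obtains P where "bounded_operator P" "\<And>x. P x \<in> M" "\<And>x. x - P x \<in> N"
    "\<And>x. x \<in> M \<Longrightarrow> P x = x" "\<And>x. x \<in> N \<Longrightarrow> P x = 0"
proof -
  have sM: "complex_vector.subspace M" and sN: "complex_vector.subspace N"
    and cM: "closed M" and cN: "closed N" using M N by (auto simp: closed_csubspace_def)
  have int: "M \<inter> N = {0}" and sum: "M + N = UNIV" using ds by (auto simp: direct_sum_def)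
  have "\<exists>m. m \<in> M \<and> x - m \<in> N" for x
  proof -
    have "x \<in> M + N" using sum by simp
    then show ?thesis by (auto simp: set_plus_def)
  qed
  then obtain P where P: "\<And>x. P x \<in> M" "\<And>x. x - P x \<in> N" by metis
  have uniq: "P x = m" if "m \<in> M" "x - m \<in> N" for x m
  proof -
    have "P x - m \<in> M" using complex_vector.subspace_diff[OF sM] P that by blast
    moreover have "(x - m) - (x - P x) \<in> N" using complex_vector.subspace_diff[OF sN] P that by blast
    then have "P x - m \<in> N" by (simp add: algebra_simps)
    ultimately have "P x - m \<in> M \<inter> N" by blast
    then show ?thesis using int by simp
  qed
  have add: "P (x + y) = P x + P y" for x y
  proof (rule uniq)
    have "(x - P x) + (y - P y) \<in> N" using complex_vector.subspace_add[OF sN] P by blast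
    then show "x + y - (P x + P y) \<in> N" by (simp add: algebra_simps)
  qed (intro complex_vector.subspace_add[OF sM] P)
  have scale: "P (c *\<^sub>C x) = c *\<^sub>C P x" for c x
  proof (rule uniq)
    have "c *\<^sub>C (x - P x) \<in> N" using complex_vector.subspace_scale[OF sN] P by blast
    then show "c *\<^sub>C x - c *\<^sub>C P x \<in> N" by (simp add: complex_vector.scale_right_diff_distrib)
  qed (intro complex_vector.subspace_scale[OF sM] P)
  let ?f = "\<lambda>z :: 'a \<times> 'a. fst z + snd z"
  have f: "bounded_linear ?f" by (intro bounded_linear_add bounded_linear_fst bounded_linear_snd)
  have img: "?f ` (M \<times> N) = UNIV" using sum by (force simp: set_plus_def)
  have subs: "subspace (M \<times> N)" using csubspace_imp_subspace[OF sM] csubspace_imp_subspace[OF sN]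
    by (auto simp: subspace_def zero_prod_def)
  have "closed (?f ` (M \<times> N))" using img by simp
  from open_mapping_bound[OF f subs closed_Times[OF cM cN] this]
  obtain C where C: "C > 0" "\<And>y. \<exists>z\<in>M \<times> N. ?f z = y \<and> norm z \<le> C * norm y"
    using img by auto
  have bound: "norm (P y) \<le> norm y * C" for y
  proof -
    obtain z where z: "z \<in> M \<times> N" "?f z = y" "norm z \<le> C * norm y" using C(2) by blast
    then have "P y = fst z" by (intro uniq) auto
    then have "norm (P y) \<le> norm z" by (metis norm_fst_le prod.collapse)
    then show ?thesis using z by (simp add: mult.commute)
  qed
  have "bounded_operator P"
    by unfold_locales (use add scale bound in \<open>auto simp: bounded_op_on_def\<close>)
  then show thesis
  proof
    show "P x = x" if "x \<in> M" for x using that complex_vector.subspace_0[OF sN] by (intro uniq) auto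
    show "P x = 0" if "x \<in> N" for x using that complex_vector.subspace_0[OF sM] by (intro uniq) auto
  qed (use P in auto)
qed

text \<open>Sums of closed subspaces need not be closed; here the sum is the set of points whose two
  components, which depend continuously on the point, lie in \<open>A\<close> and in \<open>B\<close>.\<close>

lemma closed_plus_of_direct_sum:
  fixes M N :: "'a::complex_banach set"
  assumes M: "closed_csubspace M" and N: "closed_csubspace N" and ds: "direct_sum UNIV M N"
    and A: "A \<subseteq> M" "closed A" and B: "B \<subseteq> N" "closed B"
  shows "closed (A + B)"
proof -
  obtain P where P: "bounded_operator P" "\<And>x. P x \<in> M" "\<And>x. x - P x \<in> N"
    "\<And>x. x \<in> M \<Longrightarrow> P x = x" "\<And>x. x \<in> N \<Longrightarrow> P x = 0"
    using direct_sum_projection[OF M N ds] by blast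
  interpret P: bounded_operator P by fact
  have "bounded_linear (\<lambda>x. x - P x)" by (intro bounded_linear_sub bounded_linear_ident P.bl)
  then have "closed ((\<lambda>x. x - P x) -` B)"
    by (intro closed_vimage B(2) linear_continuous_on)
  then have "closed (P -` A \<inter> (\<lambda>x. x - P x) -` B)" using P.closed_vimage[OF A(2)] by blast
  also have "P -` A \<inter> (\<lambda>x. x - P x) -` B = A + B"
  proof
    show "A + B \<subseteq> P -` A \<inter> (\<lambda>x. x - P x) -` B"
    proof
      fix x assume "x \<in> A + B"
      then obtain a b where x: "x = a + b" "a \<in> A" "b \<in> B" by (auto simp: set_plus_def)
      then have "P a = a" "P b = 0" using A(1) B(1) P(4)[of a] P(5)[of b] by auto
      then have "P x = a" using x by (simp add: P.add)
      then show "x \<in> P -` A \<inter> (\<lambda>x. x - P x) -` B" using x by auto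
    qed
    show "P -` A \<inter> (\<lambda>x. x - P x) -` B \<subseteq> A + B"
    proof
      fix x assume "x \<in> P -` A \<inter> (\<lambda>x. x - P x) -` B"
      then have "P x + (x - P x) \<in> A + B" by (intro set_plus_intro) auto
      then show "x \<in> A + B" by simp
    qed
  qed
  finally show ?thesis .
qed

section \<open>The Hahn--Banach theorem\<close>

definition sublinear :: "('a::real_vector \<Rightarrow> real) \<Rightarrow> bool" where
  "sublinear q \<longleftrightarrow> (\<forall>x y. q (x + y) \<le> q x + q y) \<and> (\<forall>t x. t \<ge> 0 \<longrightarrow> q (t *\<^sub>R x) = t * q x)"

lemma sublinear_minus_le: "sublinear q \<Longrightarrow> - q (- x) \<le> q x"
proof -
  assume q: "sublinear q"
  have "q (x + - x) \<le> q x + q (- x)" using q unfolding sublinear_def by blast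
  moreover have "q 0 = 0" using q unfolding sublinear_def
    by (metis mult_zero_left order_refl scaleR_zero_left)
  ultimately show ?thesis by simp
qed

text \<open>This is the step that makes minimal sublinear functionals linear. The new functional
  \<open>q' x = (INF t\<in>{0..}. q (x + t z) - t q z)\<close> is at most \<open>q\<close> and still sublinear, but it satisfies
  \<open>q' (- z) \<le> - q z\<close>; a minimal \<open>q\<close> must therefore agree with it and is odd, hence linear.\<close>

lemma sublinear_shrink:
  assumes q: "sublinear q"
  obtains q' where "sublinear q'" "\<And>x. q' x \<le> q x" "q' (- z) \<le> - q z"
proof -
  have sub: "\<And>x y. q (x + y) \<le> q x + q y" and hom: "\<And>t x. t \<ge> 0 \<Longrightarrow> q (t *\<^sub>R x) = t * q x"
    using q by (auto simp: sublinear_def)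
  have q0: "q 0 = 0" using hom[of 0 0] by simp
  define A where "A x = (\<lambda>t. q (x + t *\<^sub>R z) - t * q z) ` {0..}" for x
  define q' where "q' x = Inf (A x)" for x
  have ne: "A x \<noteq> {}" for x by (auto simp: A_def)
  have lower: "- q (- x) \<le> q (x + t *\<^sub>R z) - t * q z" if "t \<ge> 0" for x t
  proof -
    have "t * q z = q ((x + t *\<^sub>R z) + - x)" using hom[OF that, of z] by simp
    also have "\<dots> \<le> q (x + t *\<^sub>R z) + q (- x)" by (rule sub)
    finally show ?thesis by simp
  qed
  have bdd: "bdd_below (A x)" for x
    by (rule bdd_belowI[of _ "- q (- x)"]) (use lower in \<open>auto simp: A_def\<close>)
  have le: "q' x \<le> q (x + t *\<^sub>R z) - t * q z" if "t \<ge> 0" for x t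
    unfolding q'_def by (rule cInf_lower[OF _ bdd]) (use that in \<open>auto simp: A_def\<close>)
  have ge: "c \<le> q' x" if "\<And>t. t \<ge> 0 \<Longrightarrow> c \<le> q (x + t *\<^sub>R z) - t * q z" for c x
    unfolding q'_def by (rule cInf_greatest[OF ne]) (use that in \<open>auto simp: A_def\<close>)
  show thesis
  proof
    show "q' x \<le> q x" for x using le[of 0 x] by simp
    show "q' (- z) \<le> - q z" using le[of 1 "- z"] q0 by simp
    have q'0: "q' 0 = 0" using le[of 0 0] ge[of 0 0] q0 hom[of _ z] by force
    have add: "q' (x + y) \<le> q' x + q' y" for x y
    proof -
      have *: "q' (x + y) - (q (y + t *\<^sub>R z) - t * q z) \<le> q' x" if t: "t \<ge> 0" for t
      proof (rule ge)
        fix s :: real assume s: "s \<ge> 0"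
        have "q' (x + y) \<le> q ((x + y) + (s + t) *\<^sub>R z) - (s + t) * q z" by (rule le) (use s t in auto)
        also have "\<dots> \<le> (q (x + s *\<^sub>R z) + q (y + t *\<^sub>R z)) - (s + t) * q z"
          using sub[of "x + s *\<^sub>R z" "y + t *\<^sub>R z"] by (simp add: algebra_simps)
        finally show "q' (x + y) - (q (y + t *\<^sub>R z) - t * q z) \<le> q (x + s *\<^sub>R z) - s * q z"
          by (simp add: algebra_simps)
      qed
      then have "q' (x + y) - q' x \<le> q (y + t *\<^sub>R z) - t * q z" if "t \<ge> 0" for t
        using *[OF that] by linarith
      then have "q' (x + y) - q' x \<le> q' y" by (rule ge)
      then show ?thesis by simp
    qed
    have scale_ge: "s * q' x \<le> q' (s *\<^sub>R x)" if s: "s > 0" for s x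
    proof (rule ge)
      fix t :: real assume t: "t \<ge> 0"
      have "s * q' x \<le> s * (q (x + (t/s) *\<^sub>R z) - (t/s) * q z)"
        using s t by (intro mult_left_mono le) auto
      also have "\<dots> = q (s *\<^sub>R (x + (t/s) *\<^sub>R z)) - t * q z"
        using s by (subst hom) (auto simp: field_simps)
      finally show "s * q' x \<le> q (s *\<^sub>R x + t *\<^sub>R z) - t * q z"
        using s by (simp add: algebra_simps)
    qed
    have scale: "q' (s *\<^sub>R x) = s * q' x" if "s \<ge> 0" for s x
    proof (cases "s = 0")
      case False
      with that have s: "s > 0" by simp
      have "inverse s * q' (s *\<^sub>R x) \<le> q' (inverse s *\<^sub>R (s *\<^sub>R x))" using s by (intro scale_ge) auto
      then have "q' (s *\<^sub>R x) \<le> s * q' x" using s by (simp add: field_simps)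
      then show ?thesis using scale_ge[OF s, of x] by simp
    qed (simp add: q'0)
    show "sublinear q'" using add scale by (auto simp: sublinear_def)
  qed
qed

text \<open>Zorn's lemma for the reversed pointwise order: the pointwise infimum of a chain is finite because
  each member \<open>q\<close> satisfies \<open>- p (- x) \<le> q x\<close>.\<close>

lemma minimal_sublinear_below:
  assumes p: "sublinear p"
  shows "\<exists>q. sublinear q \<and> (\<forall>x. q x \<le> p x) \<and>
    (\<forall>r. sublinear r \<longrightarrow> (\<forall>x. r x \<le> q x) \<longrightarrow> r = q)"
proof -
  define S where "S = {q. sublinear q \<and> (\<forall>x. q x \<le> p x)}"
  let ?P = "\<lambda>q r. \<forall>x. (r x :: real) \<le> q x"
  have "\<exists>m\<in>S. \<forall>a\<in>S. ?P m a \<longrightarrow> a = m"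
  proof (rule predicate_Zorn)
    show "partial_order_on S (relation_of ?P S)"
      by (rule partial_order_on_relation_ofI) (auto intro: order.trans simp: fun_eq_iff order.eq_iff)
    fix C assume C: "C \<in> Chains (relation_of ?P S)"
    show "\<exists>u\<in>S. \<forall>a\<in>C. ?P a u"
    proof (cases "C = {}")
      case True
      then show ?thesis using p by (auto simp: S_def)
    next
      case False
      have CS: "C \<subseteq> S" and tot: "\<And>q r. q \<in> C \<Longrightarrow> r \<in> C \<Longrightarrow> ?P q r \<or> ?P r q"
        using C by (auto simp: Chains_def relation_of_def)
      define u where "u x = (INF q\<in>C. q x)" for x
      have bdd: "bdd_below ((\<lambda>q. q x) ` C)" for x
      proof (rule bdd_belowI2[of _ "- p (- x)"])
        fix q assume "q \<in> C"
        then have "sublinear q" "q (- x) \<le> p (- x)" using CS by (auto simp: S_def)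
        then show "- p (- x) \<le> q x" using sublinear_minus_le[of q x] by linarith
      qed
      have le: "u x \<le> q x" if "q \<in> C" for q x
        unfolding u_def by (rule cINF_lower[OF bdd that])
      have ge: "c \<le> u x" if "\<And>q. q \<in> C \<Longrightarrow> c \<le> q x" for c x
        unfolding u_def by (rule cINF_greatest[OF False that])
      have "u \<in> S"
        unfolding S_def sublinear_def
      proof (intro CollectI conjI allI impI)
        fix x y
        have "u (x + y) - q x \<le> r y" if "q \<in> C" "r \<in> C" for q r
        proof -
          obtain m where m: "m \<in> C" "\<And>x. m x \<le> q x" "\<And>x. m x \<le> r x" using tot[of q r] \<open>q \<in> C\<close> \<open>r \<in> C\<close> by blast
          have "u (x + y) \<le> m (x + y)" by (rule le[OF m(1)])
          also have "\<dots> \<le> m x + m y" using m(1) CS by (auto simp: S_def sublinear_def)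
          finally show ?thesis using m(2)[of x] m(3)[of y] by linarith
        qed
        then have "u (x + y) - q x \<le> u y" if "q \<in> C" for q using that by (intro ge) auto
        then have "u (x + y) - u y \<le> u x" by (intro ge) (simp add: algebra_simps)
        then show "u (x + y) \<le> u x + u y" by simp
      next
        fix t :: real and x assume t: "t \<ge> 0"
        have hom: "q (t *\<^sub>R x) = t * q x" if "q \<in> C" for q
          using that t CS by (auto simp: S_def sublinear_def)
        show "u (t *\<^sub>R x) = t * u x"
        proof (cases "t = 0")
          case True
          then have "(\<lambda>q. q (t *\<^sub>R x)) ` C = {0}" using hom False by force
          then show ?thesis using True by (simp add: u_def)
        next
          case False
          then have t: "t > 0" using t by simp
          have "u (t *\<^sub>R x) / t \<le> u x"
            by (rule ge) (use le[of _ "t *\<^sub>R x"] hom t in \<open>auto simp: field_simps\<close>)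
          moreover have "t * u x \<le> u (t *\<^sub>R x)"
          proof (rule ge)
            fix q assume q: "q \<in> C"
            show "t * u x \<le> q (t *\<^sub>R x)"
              using mult_left_mono[OF le[OF q, of x], of t] t hom[OF q] by simp
          qed
          ultimately show ?thesis using t by (auto simp: field_simps)
        qed
      next
        fix x
        obtain q where "q \<in> C" using False by auto
        then show "u x \<le> p x" using le[of q x] CS by (auto simp: S_def intro: order.trans)
      qed
      then show ?thesis using le by auto
    qed
  qed
  then obtain q where q: "q \<in> S" "\<And>r. r \<in> S \<Longrightarrow> ?P q r \<Longrightarrow> r = q" by blast
  have "r = q" if "sublinear r" "\<forall>x. r x \<le> q x" for r
  proof (rule q(2))
    show "r \<in> S" using that q(1) order.trans by (auto simp: S_def) blast
  qed (rule that)
  then show ?thesis using q(1) by (auto simp: S_def)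
qed

text \<open>The Hahn--Banach theorem for one vector. Shrinking the norm at \<open>b\<close> before passing to a minimal
  functional forces the value \<open>norm b\<close> at \<open>b\<close>.\<close>

lemma norming_functional:
  fixes b :: "'a::real_normed_vector"
  obtains u where "bounded_linear u" "u b = norm b" "\<And>x. \<bar>u x\<bar> \<le> norm x"
proof -
  have "sublinear (norm :: 'a \<Rightarrow> real)" by (auto simp: sublinear_def norm_triangle_ineq)
  then obtain p where p: "sublinear p" "\<And>x::'a. p x \<le> norm x" "p (- b) \<le> - norm b"
    using sublinear_shrink[of norm b] by blast
  obtain q where q: "sublinear q" "\<And>x. q x \<le> p x"
    and min: "\<And>r. sublinear r \<Longrightarrow> (\<And>x. r x \<le> q x) \<Longrightarrow> r = q"
    using minimal_sublinear_below[OF p(1)] by auto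
  have neg: "q (- x) = - q x" for x
  proof -
    obtain r where r: "sublinear r" "\<And>x. r x \<le> q x" "r (- x) \<le> - q x"
      using sublinear_shrink[OF q(1), of x] by blast
    have "r = q" by (rule min[OF r(1,2)])
    then show ?thesis using r(3) sublinear_minus_le[OF q(1), of x] by simp
  qed
  have sub: "q (x + y) \<le> q x + q y" and hom: "t \<ge> 0 \<Longrightarrow> q (t *\<^sub>R x) = t * q x" for x y t
    using q(1) by (auto simp: sublinear_def)
  have add: "q (x + y) = q x + q y" for x y
    using sub[of x y] sub[of "- x" "- y"] neg[of x] neg[of y] neg[of "x + y"] by simp
  have scale: "q (t *\<^sub>R x) = t * q x" for t x
  proof (cases "t \<ge> 0")
    case False
    then show ?thesis using hom[of "- t" x] neg[of "t *\<^sub>R x"] by simp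
  qed (rule hom)
  have le: "q x \<le> norm x" for x by (rule order.trans[OF q(2) p(2)])
  have abs: "\<bar>q x\<bar> \<le> norm x" for x using le[of x] le[of "- x"] neg[of x] by auto
  show thesis
  proof
    show "bounded_linear q"
      by (rule bounded_linear_intro[of _ 1]) (use add scale abs in auto)
    have "norm b \<le> q b" using q(2)[of "- b"] p(3) neg[of b] by linarith
    then show "q b = norm b" using le[of b] by simp
  qed (rule abs)
qed

text \<open>A real functional \<open>u\<close> becomes the complex functional \<open>u x - \<i> u (\<i> x)\<close>, whose real part is \<open>u\<close>.\<close>

lemma complex_functional:
  fixes b :: "'a::complex_banach"
  assumes "b \<noteq> 0"
  obtains f :: "'a \<Rightarrow> complex"
  where "bounded_linear f" "\<And>c x. f (c *\<^sub>C x) = c * f x" "f b = 1"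
proof -
  obtain u where u: "bounded_linear u" "u b = norm b" "\<And>x. \<bar>u x\<bar> \<le> norm x"
    using norming_functional[of b] by blast
  interpret u: bounded_linear u by fact
  define g where "g x = Complex (u x) (- u (\<i> *\<^sub>C x))" for x
  have gadd: "g (x + y) = g x + g y" for x y
    by (simp add: g_def u.add scaleC_add_right complex_eq_iff)
  have real: "u (complex_of_real r *\<^sub>C x) = r * u x" for r x by (simp add: scaleC_of_real u.scaleR)
  have usc: "u (c *\<^sub>C x) = Re c * u x + Im c * u (\<i> *\<^sub>C x)" for c x
  proof -
    have "c *\<^sub>C x = complex_of_real (Re c) *\<^sub>C x + complex_of_real (Im c) *\<^sub>C (\<i> *\<^sub>C x)"
      unfolding scaleC_scaleC scaleC_add_left[symmetric]
      by (rule arg_cong[where f = "\<lambda>c. c *\<^sub>C x"]) (simp add: complex_eq_iff)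
    then show ?thesis by (simp only: u.add real)
  qed
  have gscale: "g (c *\<^sub>C x) = c * g x" for c x
  proof -
    have "u (\<i> *\<^sub>C c *\<^sub>C x) = - Im c * u x + Re c * u (\<i> *\<^sub>C x)"
      using usc[of "\<i> * c" x] by (simp add: scaleC_scaleC)
    then show ?thesis by (simp add: g_def complex_eq_iff usc[of c x])
  qed
  have gb: "g b \<noteq> 0" using assms u by (simp add: g_def complex_eq_iff)
  have "norm (g x) \<le> norm x * 2" for x
  proof -
    have "norm (g x) \<le> \<bar>u x\<bar> + \<bar>u (\<i> *\<^sub>C x)\<bar>" using cmod_le[of "g x"] by (simp add: g_def)
    also have "\<dots> \<le> norm x + norm (\<i> *\<^sub>C x)" by (intro add_mono u)
    finally show ?thesis by (simp add: norm_scaleC)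
  qed
  then have blg: "bounded_linear g"
    using gadd gscale[of "of_real _"]
    by (intro bounded_linear_intro[of _ 2]) (auto simp: scaleC_of_real scaleR_conv_of_real)
  show thesis
  proof
    show "bounded_linear (\<lambda>x. inverse (g b) * g x)"
      by (rule bounded_linear_const_mult[OF blg])
  qed (use gscale gb in auto)
qed

section \<open>Subspaces of finite dimension or codimension\<close>

text \<open>Induction on a finite spanning set. If \<open>P\<close> projects onto the span so far and \<open>b\<close> is a new vector
  with \<open>e = b - P b \<noteq> 0\<close>, then \<open>P x + f (x - P x) e\<close> with \<open>f e = 1\<close> projects onto the larger span.\<close>

lemma finite_cdim_projection:
  fixes V :: "'a::complex_banach set"
  assumes "finite_cdim V"
  obtains P where "bounded_operator P" "\<And>x. P x \<in> V" "\<And>x. x \<in> V \<Longrightarrow> P x = x"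
proof -
  have *: "\<exists>P. bounded_operator P \<and> (\<forall>x. P x \<in> complex_vector.span B) \<and>
      (\<forall>x\<in>complex_vector.span B. P x = x)" if "finite B" for B :: "'a set"
    using that
  proof induction
    case empty
    have "bounded_operator (\<lambda>_. 0 :: 'a)"
      by unfold_locales (simp add: bounded_op_on_UNIV)
    then show ?case by (intro exI[of _ "\<lambda>_. 0"]) auto
  next
    case (insert b B)
    then obtain P where P: "bounded_operator P" "\<And>x. P x \<in> complex_vector.span B"
      "\<And>x. x \<in> complex_vector.span B \<Longrightarrow> P x = x" by blast
    interpret P: bounded_operator P by fact
    define e where "e = b - P b"
    show ?case
    proof (cases "e = 0")
      case True
      then have "b \<in> complex_vector.span B" using P(2)[of b] by (simp add: e_def)
      then have "complex_vector.span (insert b B) = complex_vector.span B"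
        by (rule complex_vector.span_redundant)
      then show ?thesis using P by auto
    next
      case False
      then obtain f :: "'a \<Rightarrow> complex" where f: "bounded_linear f" "\<And>c x. f (c *\<^sub>C x) = c * f x" "f e = 1"
        using complex_functional[of e] by blast
      interpret f: bounded_linear f by fact
      define Q where "Q x = P x + f (x - P x) *\<^sub>C e" for x
      have Pe: "P e = 0" using P(2,3) by (simp add: e_def P.diff)
      have sub: "complex_vector.span B \<subseteq> complex_vector.span (insert b B)"
        by (rule complex_vector.span_mono) auto
      have "b \<in> complex_vector.span (insert b B)" by (rule complex_vector.span_base) simp
      then have eB: "e \<in> complex_vector.span (insert b B)"
        unfolding e_def
        using P(2)[of b] sub by (auto intro: complex_vector.span_diff)
      have 1: "Q x \<in> complex_vector.span (insert b B)" for x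
        unfolding Q_def
        using P(2)[of x] sub eB by (auto intro: complex_vector.span_add complex_vector.span_scale)
      have 2: "Q x = x" if x: "x \<in> complex_vector.span (insert b B)" for x
      proof -
        obtain k where k: "x - k *\<^sub>C b \<in> complex_vector.span B"
          using x complex_vector.span_breakdown_eq by blast
        have "P (x - k *\<^sub>C b) = x - k *\<^sub>C b" by (rule P(3)[OF k])
        then have "x - P x = k *\<^sub>C b - k *\<^sub>C P b"
          by (simp add: P.diff P.scaleC) (simp add: algebra_simps)
        then have "x - P x = k *\<^sub>C e"
          by (simp add: e_def complex_vector.scale_right_diff_distrib)
        moreover from this have "f (x - P x) = k" using f(2,3) by simp
        ultimately have "Q x = P x + (x - P x)" by (simp add: Q_def)
        then show ?thesis by simp
      qed
      obtain K1 where K1: "\<And>x. norm (P x) \<le> norm x * K1" using P.bounded by (auto simp: bounded_op_on_def)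
      obtain K2 where K2: "\<And>x. norm (f x) \<le> norm x * K2" "K2 \<ge> 0" using f.nonneg_bounded by blast
      have "norm (Q x) \<le> norm x * (K1 + (1 + K1) * K2 * norm e)" for x
      proof -
        have "norm (Q x) \<le> norm (P x) + norm (f (x - P x)) * norm e"
          unfolding Q_def by (rule order.trans[OF norm_triangle_ineq]) (simp add: norm_scaleC)
        also have "\<dots> \<le> norm x * K1 + (norm (x - P x) * K2) * norm e"
          by (intro add_mono K1 mult_right_mono K2) auto
        also have "\<dots> \<le> norm x * K1 + ((norm x + norm x * K1) * K2) * norm e"
          by (intro add_mono mult_right_mono order.refl K2 order.trans[OF norm_triangle_ineq4] K1) auto
        finally show ?thesis by (simp add: algebra_simps)
      qed
      moreover have "Q (x + y) = Q x + Q y" for x y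
      proof -
        have "f (x + y - P (x + y)) = f (x - P x) + f (y - P y)"
          by (simp add: P.add f.add f.diff)
        then show ?thesis by (simp add: Q_def P.add scaleC_add_left)
      qed
      moreover have "Q (c *\<^sub>C x) = c *\<^sub>C Q x" for c x
      proof -
        have "c *\<^sub>C x - P (c *\<^sub>C x) = c *\<^sub>C (x - P x)"
          by (simp add: P.scaleC complex_vector.scale_right_diff_distrib)
        then show ?thesis by (simp add: Q_def P.scaleC f(2) scaleC_add_right scaleC_scaleC)
      qed
      ultimately have "bounded_operator Q"
        by unfold_locales (auto simp: bounded_op_on_def)
      then show ?thesis using 1 2 by blast
    qed
  qed
  obtain B where B: "finite B" "complex_vector.span B = V"
    using assms by (auto simp: finite_cdim_def)
  show thesis using *[OF B(1)] that unfolding B(2) by auto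
qed

lemma finite_cdim_complemented:
  assumes "finite_cdim V"
  shows "top_complemented_in UNIV V"
proof -
  obtain P where P: "bounded_operator P" "\<And>x. P x \<in> V" "\<And>x. x \<in> V \<Longrightarrow> P x = x"
    using finite_cdim_projection[OF assms] by blast
  interpret P: bounded_operator P by fact
  have sV: "complex_vector.subspace V" using assms by (auto simp: finite_cdim_def)
  have "V = {x. P x = x}"
  proof
    show "V \<subseteq> {x. P x = x}" using P(3) by blast
    show "{x. P x = x} \<subseteq> V"
    proof
      fix x assume "x \<in> {x. P x = x}"
      then show "x \<in> V" using P(2)[of x] by simp
    qed
  qed
  moreover have "closed {x. P x = x}"
    by (intro closed_Collect_eq linear_continuous_on P.bl continuous_on_id)
  ultimately have cV: "closed_csubspace V" using sV by (simp add: closed_csubspace_def)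
  have cW: "closed_csubspace (ker P)"
    by (simp add: closed_csubspace_def P.subspace_ker_on P.closed_ker_on)
  have "V \<inter> ker P \<subseteq> {0}" using P(3) by (force simp: ker_on_def)
  then have "V \<inter> ker P = {0}"
    using complex_vector.subspace_0[OF sV] by (auto simp: ker_on_def P.zero)
  moreover have "x \<in> V + ker P" for x
  proof -
    have "P x + (x - P x) \<in> V + ker P"
      using P(2)[of x] P(3)[OF P(2)] by (intro set_plus_intro) (simp_all add: ker_on_def P.diff)
    then show ?thesis by simp
  qed
  ultimately have "direct_sum UNIV V (ker P)"
    using sV cW by (auto simp: direct_sum_def closed_csubspace_def)
  then show ?thesis using cV cW by (auto simp: top_complemented_in_def)
qed

text \<open>A nonzero vector of \<open>L\<close> in the span of \<open>B\<close> would express some member of \<open>B\<close> by \<open>L\<close> and the others,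
  and that member could be discarded.\<close>

lemma minimal_supplement_disjoint:
  assumes L: "complex_vector.subspace L" and B: "finite B" "L + complex_vector.span B = UNIV"
    and min: "\<And>B'. finite B' \<Longrightarrow> L + complex_vector.span B' = UNIV \<Longrightarrow> card B \<le> card B'"
  shows "L \<inter> complex_vector.span B = {0}"
proof (rule ccontr)
  assume "L \<inter> complex_vector.span B \<noteq> {0}"
  then obtain x where x: "x \<in> L" "x \<in> complex_vector.span B" "x \<noteq> 0"
    using complex_vector.subspace_0[OF L] complex_vector.span_zero by blast
  obtain u where u: "x = (\<Sum>b\<in>B. u b *\<^sub>C b)"
    using x(2) B(1) by (auto simp: complex_vector.span_finite)
  obtain b where b: "b \<in> B" "u b \<noteq> 0"
    using u x(3) sum.neutral[of B "\<lambda>b. u b *\<^sub>C b"] complex_vector.scale_zero_left by metis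
  let ?C = "complex_vector.span (B - {b})"
  have LC: "complex_vector.subspace (L + ?C)" using L by (intro csubspace_plus) auto
  have sub: "L \<subseteq> L + ?C" "?C \<subseteq> L + ?C"
    using complex_vector.subspace_0[OF L] complex_vector.span_zero
    by (force simp: set_plus_def)+
  have "x - (\<Sum>b\<in>B - {b}. u b *\<^sub>C b) = u b *\<^sub>C b"
    using u b B(1) by (simp add: sum.remove)
  moreover have "(\<Sum>b\<in>B - {b}. u b *\<^sub>C b) \<in> ?C"
    by (rule complex_vector.span_sum) (rule complex_vector.span_scale, rule complex_vector.span_base)
  ultimately have "u b *\<^sub>C b \<in> L + ?C"
    using complex_vector.subspace_diff[OF LC, of x "\<Sum>b\<in>B - {b}. u b *\<^sub>C b"] x(1) sub by auto
  from complex_vector.subspace_scale[OF LC this, of "inverse (u b)"]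
  have "b \<in> L + ?C" using b by (simp add: scaleC_scaleC)
  moreover have "B - {b} \<subseteq> L + ?C"
    using sub(2) complex_vector.span_superset[of "B - {b}"] by (rule order.trans[rotated])
  ultimately have "complex_vector.span B \<subseteq> L + ?C"
    using LC by (intro complex_vector.span_minimal) auto
  then have "L + complex_vector.span B \<subseteq> L + ?C"
    using complex_vector.subspace_add[OF LC] sub(1) by (auto elim!: set_plus_elim)
  then have "L + ?C = UNIV" using B(2) by auto
  from min[OF _ this] have "card B \<le> card (B - {b})" using B(1) by simp
  then show False using card_Diff1_less[OF B(1) b(1)] by linarith
qed

lemma finite_ccodim_complemented:
  assumes L: "closed_csubspace L" and "finite_ccodim L"
  shows "top_complemented_in UNIV L"
proof -
  have sL: "complex_vector.subspace L" using L by (simp add: closed_csubspace_def)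
  let ?Q = "\<lambda>B. finite B \<and> L + complex_vector.span B = UNIV"
  obtain B0 where "?Q B0" using assms(2) by (auto simp: finite_ccodim_def)
  then obtain B where B: "?Q B" "\<And>B'. ?Q B' \<Longrightarrow> card B \<le> card B'"
    using ex_has_least_nat[of ?Q B0 card] by blast
  have "finite_cdim (complex_vector.span B)" using B(1) by (auto simp: finite_cdim_def)
  then have "closed_csubspace (complex_vector.span B)"
    using finite_cdim_complemented by (auto simp: top_complemented_in_def)
  moreover have "direct_sum UNIV L (complex_vector.span B)"
    using minimal_supplement_disjoint[OF sL] B sL by (auto simp: direct_sum_def)
  ultimately show ?thesis using L by (auto simp: top_complemented_in_def)
qed

section \<open>Decompositions of Saphar type from complements\<close>

text \<open>The numbers with this property form an up-set, and the degree of stable iteration is their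
  infimum.\<close>

definition kernel_stable :: "('a::complex_banach \<Rightarrow> 'a) \<Rightarrow> nat \<Rightarrow> bool" where
  "kernel_stable T d \<longleftrightarrow> (\<forall>m. ker T \<inter> range (T ^^ d) \<subseteq> range (T ^^ m))"

text \<open>For \<open>j \<le> d\<close> this is the sum of \<open>range (T ^^ d)\<close> and of the subspaces \<open>(T ^^ k) ` L\<close> with
  \<open>d - j \<le> k < d\<close>. The stage \<open>j = d\<close> will be the Saphar part of a decomposition. The recursion runs
  downwards in the power of \<open>T\<close> because closedness is proved by adding one summand at a time to the
  closed subspace \<open>range (T ^^ d)\<close>.\<close>

primrec tower :: "('a::complex_banach \<Rightarrow> 'a) \<Rightarrow> 'a set \<Rightarrow> nat \<Rightarrow> nat \<Rightarrow> 'a set" where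
  "tower T L d 0 = range (T ^^ d)"
| "tower T L d (Suc j) = (T ^^ (d - Suc j)) ` L + tower T L d j"

text \<open>The dual of the tower: instead of adding images of a complement of \<open>range T + ker (T ^^ d)\<close>, it
  intersects preimages of a complement \<open>W\<close> of \<open>ker T \<inter> range (T ^^ d)\<close>.\<close>

definition nilpotent_part :: "('a::complex_banach \<Rightarrow> 'a) \<Rightarrow> 'a set \<Rightarrow> nat \<Rightarrow> 'a set" where
  "nilpotent_part T W d = ker (T ^^ d) \<inter> (\<Inter>k<d. (T ^^ k) -` W)"

lemma plus_subset_csubspace:
  "complex_vector.subspace S \<Longrightarrow> A \<subseteq> S \<Longrightarrow> B \<subseteq> S \<Longrightarrow> A + B \<subseteq> S"
  by (auto elim!: set_plus_elim intro: complex_vector.subspace_add)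

context bounded_operator
begin

lemma pow_zero: "(T ^^ n) 0 = 0" and pow_add: "(T ^^ n) (x + y) = (T ^^ n) x + (T ^^ n) y"
  and pow_diff: "(T ^^ n) (x - y) = (T ^^ n) x - (T ^^ n) y"
  and pow_scaleC: "(T ^^ n) (c *\<^sub>C x) = c *\<^sub>C (T ^^ n) x"
proof -
  interpret P: bounded_operator "T ^^ n" by (rule power)
  show "(T ^^ n) 0 = 0" "(T ^^ n) (x + y) = (T ^^ n) x + (T ^^ n) y"
    "(T ^^ n) (x - y) = (T ^^ n) x - (T ^^ n) y" "(T ^^ n) (c *\<^sub>C x) = c *\<^sub>C (T ^^ n) x"
    by (rule P.zero P.add P.diff P.scaleC)+
qed

lemma pow_pow: "(T ^^ m) ((T ^^ n) x) = (T ^^ (m + n)) x"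
  by (simp add: funpow_add)

lemma pow_T: "(T ^^ n) (T x) = (T ^^ Suc n) x"
  by (simp add: funpow_swap1)

lemma subspace_range_pow: "complex_vector.subspace (range (T ^^ n))"
  using bounded_operator.subspace_image[OF power] by simp

lemma subspace_ker_pow: "complex_vector.subspace (ker (T ^^ n))"
  using bounded_operator.subspace_ker_on[OF power] by simp

lemma range_pow_mono: "m \<le> n \<Longrightarrow> range (T ^^ n) \<subseteq> range (T ^^ m)"
  using pow_pow[of m "n - m"] by (metis image_subsetI le_add_diff_inverse rangeI)

lemma ker_pow_mono: "m \<le> n \<Longrightarrow> ker (T ^^ m) \<subseteq> ker (T ^^ n)"
  using pow_pow[of "n - m" m] pow_zero[of "n - m"] by (auto simp: ker_on_def) (metis le_add_diff_inverse2)

text \<open>In this form the subspace is visibly closed as soon as \<open>range (T ^^ Suc d)\<close> is.\<close>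

lemma range_plus_ker_pow: "range T + ker (T ^^ d) = (T ^^ d) -` range (T ^^ Suc d)"
proof
  show "range T + ker (T ^^ d) \<subseteq> (T ^^ d) -` range (T ^^ Suc d)"
  proof
    fix x assume "x \<in> range T + ker (T ^^ d)"
    then obtain u v where "x = T u + v" "(T ^^ d) v = 0" by (auto simp: set_plus_def ker_on_def)
    then have "(T ^^ d) x = (T ^^ Suc d) u" by (simp add: pow_add pow_T)
    then show "x \<in> (T ^^ d) -` range (T ^^ Suc d)" by (metis rangeI vimage_eq)
  qed
  show "(T ^^ d) -` range (T ^^ Suc d) \<subseteq> range T + ker (T ^^ d)"
  proof
    fix x assume "x \<in> (T ^^ d) -` range (T ^^ Suc d)"
    then obtain u where "(T ^^ d) x = (T ^^ Suc d) u" by auto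
    then have "x - T u \<in> ker (T ^^ d)" by (simp add: ker_on_def pow_diff pow_T)
    then have "T u + (x - T u) \<in> range T + ker (T ^^ d)" by (intro set_plus_intro) auto
    then show "x \<in> range T + ker (T ^^ d)" by simp
  qed
qed

text \<open>The Kato condition speaks of the kernel of \<open>T\<close> only, but it carries over to the kernels of the
  powers: if \<open>(T ^^ i) x\<close> is in the kernel, it equals \<open>(T ^^ (i + n)) w\<close>, and \<open>x - (T ^^ n) w\<close> is
  annihilated by a smaller power.\<close>

lemma ker_pow_subset_image_pow:
  assumes Y: "complex_vector.subspace Y" "T ` Y \<subseteq> Y"
    and ker: "\<And>n. ker_on Y T \<subseteq> (T ^^ n) ` Y"
    and x: "x \<in> Y" "(T ^^ i) x = 0"
  shows "x \<in> (T ^^ n) ` Y"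
  using x
proof (induction i arbitrary: x)
  case 0
  then have "x = (T ^^ n) 0" by (simp add: pow_zero)
  then show ?case using complex_vector.subspace_0[OF Y(1)] by blast
next
  case (Suc i)
  have inv: "(T ^^ k) y \<in> Y" if "y \<in> Y" for k y
    using that Y(2) by (induction k) auto
  have "(T ^^ i) x \<in> ker_on Y T" using Suc.prems inv[of x i] by (simp add: ker_on_def)
  then obtain w where w: "(T ^^ i) x = (T ^^ (i + n)) w" "w \<in> Y" using ker[of "i + n"] by auto
  have "(T ^^ i) (x - (T ^^ n) w) = 0" by (simp add: pow_diff w pow_pow)
  moreover have "x - (T ^^ n) w \<in> Y"
    using Suc.prems(1) inv[OF w(2)] by (rule complex_vector.subspace_diff[OF Y(1)])
  ultimately have "x - (T ^^ n) w \<in> (T ^^ n) ` Y" by (rule Suc.IH[rotated])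
  then obtain v where "x - (T ^^ n) w = (T ^^ n) v" "v \<in> Y" by auto
  then have "x = (T ^^ n) (v + w)" "v + w \<in> Y"
    using w(2) complex_vector.subspace_add[OF Y(1)] by (auto simp: pow_add algebra_simps)
  then show ?case by blast
qed

lemma range_pow_image: "range (T ^^ (m + n)) = (T ^^ m) ` range (T ^^ n)"
  by (simp add: funpow_add image_comp)

lemma kernel_stable_pow:
  assumes "kernel_stable T d" "x \<in> range (T ^^ d)" "(T ^^ i) x = 0"
  shows "x \<in> range (T ^^ n)"
proof -
  have "x \<in> (T ^^ n) ` range (T ^^ d)"
  proof (rule ker_pow_subset_image_pow[OF subspace_range_pow _ _ assms(2,3)])
    show "T ` range (T ^^ d) \<subseteq> range (T ^^ d)"
      using range_pow_mono[of d "Suc d"] by (simp add: image_comp comp_def)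
    show "ker_on (range (T ^^ d)) T \<subseteq> (T ^^ n) ` range (T ^^ d)" for n
      using assms(1) unfolding range_pow_image[symmetric] by (auto simp: kernel_stable_def ker_on_def)
  qed
  then show ?thesis by auto
qed

lemma subspace_tower: "complex_vector.subspace L \<Longrightarrow> complex_vector.subspace (tower T L d j)"
proof (induction j)
  case (Suc j)
  then show ?case
    using bounded_operator.subspace_image[OF power] by (auto intro!: csubspace_plus)
qed (simp add: subspace_range_pow)

lemma tower_mono: "complex_vector.subspace L \<Longrightarrow> tower T L d j \<subseteq> tower T L d (Suc j)"
proof
  fix x assume L: "complex_vector.subspace L" and x: "x \<in> tower T L d j"
  have "0 \<in> (T ^^ (d - Suc j)) ` L" using complex_vector.subspace_0[OF L] pow_zero by (metis imageI)
  then have "0 + x \<in> tower T L d (Suc j)" using x by (simp only: tower.simps set_plus_intro)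
  then show "x \<in> tower T L d (Suc j)" by simp
qed

lemma range_subset_tower: "complex_vector.subspace L \<Longrightarrow> range (T ^^ d) \<subseteq> tower T L d j"
  by (induction j) (use tower_mono in \<open>simp, blast\<close>)

lemma tower_subset_range: "j \<le> d \<Longrightarrow> tower T L d j \<subseteq> range (T ^^ (d - j))"
proof (induction j)
  case (Suc j)
  have "tower T L d j \<subseteq> range (T ^^ (d - Suc j))"
    using Suc order.trans[OF _ range_pow_mono[of "d - Suc j" "d - j"]] by simp
  then show ?case unfolding tower.simps
    by (intro plus_subset_csubspace[OF subspace_range_pow]) auto
qed simp

lemma image_plus: "T ` (A + B) = T ` A + T ` B"
proof
  show "T ` (A + B) \<subseteq> T ` A + T ` B" by (auto simp: add elim!: set_plus_elim intro!: set_plus_intro)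
  show "T ` A + T ` B \<subseteq> T ` (A + B)"
  proof
    fix y assume "y \<in> T ` A + T ` B"
    then obtain a b where "y = T a + T b" "a \<in> A" "b \<in> B" by (auto elim!: set_plus_elim)
    then have "y = T (a + b)" "a + b \<in> A + B" by (simp_all add: add set_plus_intro)
    then show "y \<in> T ` (A + B)" by blast
  qed
qed

text \<open>Applying \<open>T\<close> lowers the stage by one. The lowest stage is reproduced because the covering
  hypothesis gives \<open>range (T ^^ d) = (T ^^ d) ` L + range (T ^^ Suc d)\<close>.\<close>

lemma image_tower:
  assumes "L + (range T + ker (T ^^ d)) = UNIV" "j < d"
  shows "T ` tower T L d (Suc j) = tower T L d j"
  using assms(2)
proof (induction j)
  case 0
  have "range (T ^^ d) = (T ^^ d) ` L + range (T ^^ Suc d)"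
  proof
    show "range (T ^^ d) \<subseteq> (T ^^ d) ` L + range (T ^^ Suc d)"
    proof
      fix y assume "y \<in> range (T ^^ d)"
      then obtain x where y: "y = (T ^^ d) x" by auto
      have "x \<in> L + (range T + ker (T ^^ d))" using assms(1) by simp
      then obtain l s where "x = l + s" "l \<in> L" "s \<in> range T + ker (T ^^ d)" by (rule set_plus_elim)
      then have "y = (T ^^ d) l + (T ^^ d) s" "(T ^^ d) s \<in> range (T ^^ Suc d)"
        using y by (auto simp: pow_add range_plus_ker_pow)
      then show "y \<in> (T ^^ d) ` L + range (T ^^ Suc d)" using \<open>l \<in> L\<close> by (auto intro: set_plus_intro)
    qed
    show "(T ^^ d) ` L + range (T ^^ Suc d) \<subseteq> range (T ^^ d)"
      by (intro plus_subset_csubspace subspace_range_pow range_pow_mono) auto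
  qed
  moreover have "T ` (T ^^ (d - Suc 0)) ` L = (T ^^ d) ` L"
    using 0 by (cases d) (auto simp: image_image)
  moreover have "T ` range (T ^^ d) = range (T ^^ Suc d)" by (auto simp: image_image)
  ultimately show ?case unfolding tower.simps image_plus by simp
next
  case (Suc j)
  have "T ` (T ^^ (d - Suc (Suc j))) ` L = (T ^^ (d - Suc j)) ` L"
    using Suc.prems Suc_diff_Suc[of "Suc j" d] by (auto simp: image_image simp flip: Suc_diff_Suc)
  then show ?case using Suc by (simp add: image_plus)
qed

lemma tower_invariant:
  assumes "L + (range T + ker (T ^^ d)) = UNIV" "complex_vector.subspace L"
  shows "T ` tower T L d d \<subseteq> tower T L d d"
proof (cases d)
  case (Suc e)
  then show ?thesis using image_tower[OF assms(1), of e] tower_mono[OF assms(2), of d e] by simp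
qed simp

text \<open>The summands \<open>(T ^^ k) ` L\<close> contain nothing that a power of \<open>T\<close> annihilates. Let \<open>(T ^^ k) l\<close> be the
  summand with the lowest power in a decomposition of \<open>x\<close>. Then \<open>(T ^^ d) l\<close> is congruent modulo
  \<open>range (T ^^ Suc d)\<close> to a vector of \<open>range (T ^^ d)\<close> that a power of \<open>T\<close> annihilates, and such
  vectors are in \<open>range (T ^^ Suc d)\<close>; so \<open>l\<close> lies in \<open>range T + ker (T ^^ d)\<close> and vanishes.\<close>

lemma tower_ker:
  assumes st: "kernel_stable T d" and L: "complex_vector.subspace L"
    and int: "L \<inter> (range T + ker (T ^^ d)) = {0}"
  shows "j \<le> d \<Longrightarrow> x \<in> tower T L d j \<Longrightarrow> (T ^^ m) x = 0 \<Longrightarrow> x \<in> range (T ^^ d)"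
proof (induction j)
  case (Suc j)
  from Suc.prems obtain l v where x: "x = (T ^^ (d - Suc j)) l + v" "l \<in> L" "v \<in> tower T L d j"
    by (auto elim!: set_plus_elim)
  have "v \<in> range (T ^^ (d - j))" using tower_subset_range[of j d L] x(3) Suc.prems by auto
  then obtain w where w: "v = (T ^^ (d - j)) w" by auto
  have e: "(T ^^ Suc j) x = (T ^^ d) l + (T ^^ Suc d) w"
    using Suc.prems unfolding x(1) w pow_add pow_pow by (simp add: Suc_diff_le)
  have m: "(T ^^ m) ((T ^^ Suc j) x) = 0"
    by (metis pow_pow add.commute Suc.prems(3) pow_zero)
  have "(T ^^ Suc d) w \<in> range (T ^^ d)"
    by (rule subsetD[OF range_pow_mono[of d "Suc d"]]) auto
  then have "(T ^^ Suc j) x \<in> range (T ^^ d)"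
    unfolding e by (intro complex_vector.subspace_add[OF subspace_range_pow]) auto
  then have "(T ^^ Suc j) x \<in> range (T ^^ Suc d)" using kernel_stable_pow[OF st _ m] by blast
  then have "(T ^^ Suc j) x - (T ^^ Suc d) w \<in> range (T ^^ Suc d)"
    by (intro complex_vector.subspace_diff[OF subspace_range_pow]) auto
  then have "l \<in> range T + ker (T ^^ d)" unfolding range_plus_ker_pow e by simp
  then have "l = 0" using int x(2) by auto
  then have "x \<in> tower T L d j" using x by (simp add: pow_zero)
  then show ?case using Suc by simp
qed simp

text \<open>Applying \<open>T ^^ k\<close> to the decomposition of the whole space into \<open>L\<close>, \<open>range T\<close> and \<open>ker (T ^^ d)\<close>
  splits \<open>range (T ^^ k)\<close> into \<open>(T ^^ k) ` L\<close>, \<open>range (T ^^ Suc k)\<close> and a part of \<open>ker (T ^^ d)\<close>.\<close>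

lemma tower_covers:
  assumes UN: "L + (range T + ker (T ^^ d)) = UNIV"
  shows "j \<le> d \<Longrightarrow> range (T ^^ (d - j)) \<subseteq> tower T L d j + ker (T ^^ d)"
proof (induction j)
  case 0
  show ?case using complex_vector.subspace_0[OF subspace_ker_pow] by (force simp: set_plus_def)
next
  case (Suc j)
  define k where "k = d - Suc j"
  have k: "d - j = Suc k" using Suc.prems by (simp add: k_def)
  show ?case
  proof
    fix x assume "x \<in> range (T ^^ (d - Suc j))"
    then obtain u where u: "x = (T ^^ k) u" by (auto simp: k_def)
    have "u \<in> L + (range T + ker (T ^^ d))" using UN by simp
    then obtain l w n where lwn: "u = l + (T w + n)" "l \<in> L" "n \<in> ker (T ^^ d)"
      by (auto elim!: set_plus_elim)
    have "(T ^^ Suc k) w \<in> tower T L d j + ker (T ^^ d)" using Suc k by auto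
    then obtain t n' where t: "(T ^^ Suc k) w = t + n'" "t \<in> tower T L d j" "n' \<in> ker (T ^^ d)"
      by (rule set_plus_elim)
    have "(T ^^ d) ((T ^^ k) n) = 0"
      using lwn(3) by (metis (mono_tags, lifting) ker_on_def mem_Collect_eq pow_pow add.commute pow_zero)
    then have "n' + (T ^^ k) n \<in> ker (T ^^ d)" using t(3) by (simp add: ker_on_def pow_add)
    moreover have "x = ((T ^^ k) l + t) + (n' + (T ^^ k) n)"
      unfolding u lwn(1) pow_add pow_T t(1) by simp
    moreover have "(T ^^ k) l + t \<in> tower T L d (Suc j)"
      using lwn(2) t(2) by (auto simp: k_def intro: set_plus_intro)
    ultimately show "x \<in> tower T L d (Suc j) + ker (T ^^ d)" by (simp only: set_plus_intro)
  qed
qed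

text \<open>The component of \<open>z\<close> in the new summand \<open>(T ^^ k) ` L\<close> is recovered continuously from \<open>z\<close>. Let
  \<open>P\<close> be the projection onto \<open>L\<close> along \<open>range T + ker (T ^^ d)\<close>. The map \<open>G\<close> that takes \<open>(T ^^ d) x\<close>
  to \<open>P x\<close> is well defined and, by the open mapping theorem for \<open>T ^^ d\<close>, continuous on the closed
  range of \<open>T ^^ d\<close>; if \<open>z = (T ^^ k) l + v\<close> with \<open>v\<close> in the previous stage and \<open>k + Suc j = d\<close>, then
  \<open>l = G ((T ^^ Suc j) z)\<close>. The new stage is thus the preimage of a closed set under a continuous map.\<close>

lemma closed_tower:
  assumes cd: "closed (range (T ^^ d))" and L: "closed_csubspace L"
    and S: "closed_csubspace (range T + ker (T ^^ d))"
    and ds: "direct_sum UNIV L (range T + ker (T ^^ d))"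
  shows "j \<le> d \<Longrightarrow> closed (tower T L d j)"
proof -
  have sL: "complex_vector.subspace L" using L by (simp add: closed_csubspace_def)
  obtain P where P: "bounded_operator P" "\<And>x. P x \<in> L" "\<And>x. x - P x \<in> range T + ker (T ^^ d)"
    "\<And>x. x \<in> L \<Longrightarrow> P x = x" "\<And>x. x \<in> range T + ker (T ^^ d) \<Longrightarrow> P x = 0"
    using direct_sum_projection[OF L S ds] by blast
  interpret P: bounded_operator P by fact
  interpret Td: bounded_operator "T ^^ d" by (rule power)
  obtain C where C: "C > 0" "\<And>y. y \<in> range (T ^^ d) \<Longrightarrow> \<exists>x\<in>UNIV. (T ^^ d) x = y \<and> norm x \<le> C * norm y"
    using open_mapping_bound[OF Td.bl, of UNIV] cd by auto
  obtain K where K: "\<And>x. norm (P x) \<le> norm x * K" "K \<ge> 0" using P.nonneg_bounded by blast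
  define G where "G y = P (SOME x. (T ^^ d) x = y)" for y
  have zero: "P x = 0" if "x \<in> range T" for x
  proof -
    have "x + 0 \<in> range T + ker (T ^^ d)"
      using that complex_vector.subspace_0[OF subspace_ker_pow] by (intro set_plus_intro)
    then show ?thesis using P(5) by simp
  qed
  have kz: "P x = 0" if "(T ^^ d) x = 0" for x
  proof -
    have "T 0 + x \<in> range T + ker (T ^^ d)"
      by (rule set_plus_intro[OF rangeI]) (simp add: that ker_on_def)
    then show ?thesis using P(5) by (simp add: local.zero)
  qed
  have G: "G ((T ^^ d) x) = P x" for x
  proof -
    define x' where "x' = (SOME x'. (T ^^ d) x' = (T ^^ d) x)"
    have "(T ^^ d) x' = (T ^^ d) x" unfolding x'_def by (rule someI[of _ x]) simp
    then have "P (x' - x) = 0" by (intro kz) (simp add: pow_diff)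
    then show ?thesis by (simp add: G_def x'_def P.diff)
  qed
  have lip: "norm (G y - G z) \<le> K * C * norm (y - z)" if yz: "y \<in> range (T ^^ d)" "z \<in> range (T ^^ d)" for y z
  proof -
    have "y - z \<in> range (T ^^ d)" using yz by (rule complex_vector.subspace_diff[OF subspace_range_pow])
    then obtain x where x: "(T ^^ d) x = y - z" "norm x \<le> C * norm (y - z)" using C(2) by blast
    obtain u v where uv: "y = (T ^^ d) u" "z = (T ^^ d) v" using yz by auto
    have "G y - G z = P (u - v)" by (simp add: uv G P.diff)
    also have "\<dots> = P x" using kz[of "(u - v) - x"] x(1) by (simp add: uv pow_diff P.diff)
    finally have "norm (G y - G z) \<le> norm x * K" using K by simp
    also have "\<dots> \<le> (C * norm (y - z)) * K" using x(2) K(2) by (rule mult_right_mono)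
    finally show ?thesis by (simp add: mult_ac)
  qed
  have contG: "continuous_on (range (T ^^ d)) G"
  proof -
    have "(K * C)-lipschitz_on (range (T ^^ d)) G"
      using lip K(2) C(1) by (intro lipschitz_onI) (auto simp: dist_norm)
    then show ?thesis by (rule lipschitz_on_continuous_on)
  qed
  show "j \<le> d \<Longrightarrow> closed (tower T L d j)"
  proof (induction j)
    case 0
    show ?case using cd by simp
  next
    case (Suc j)
    define k where "k = d - Suc j"
    interpret Tk: bounded_operator "T ^^ k" by (rule power)
    interpret Tj: bounded_operator "T ^^ Suc j" by (rule power)
    define S where "S = (T ^^ Suc j) -` range (T ^^ d)"
    let ?h = "\<lambda>z. z - (T ^^ k) (G ((T ^^ Suc j) z))"
    have cS: "closed S" unfolding S_def by (rule Tj.closed_vimage[OF cd])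
    have "continuous_on S (\<lambda>z. G ((T ^^ Suc j) z))"
      by (rule continuous_on_compose2[OF contG linear_continuous_on[OF Tj.bl]]) (auto simp: S_def)
    then have "continuous_on S ?h"
      by (intro continuous_on_diff continuous_on_id Tk.continuous_on)
    then have "closed (S \<inter> ?h -` tower T L d j)"
      using cS Suc by (intro continuous_closed_preimage) auto
    also have "S \<inter> ?h -` tower T L d j = tower T L d (Suc j)"
    proof
      show "S \<inter> ?h -` tower T L d j \<subseteq> tower T L d (Suc j)"
      proof
        fix z assume "z \<in> S \<inter> ?h -` tower T L d j"
        then have h: "?h z \<in> tower T L d j" by blast
        have "G ((T ^^ Suc j) z) \<in> L" unfolding G_def by (rule P(2))
        from set_plus_intro[OF imageI[OF this, of "T ^^ k"] h]
        have "(T ^^ k) (G ((T ^^ Suc j) z)) + ?h z \<in> tower T L d (Suc j)"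
          unfolding tower.simps k_def .
        moreover have "(T ^^ k) (G ((T ^^ Suc j) z)) + ?h z = z" by simp
        ultimately show "z \<in> tower T L d (Suc j)" by simp
      qed
      show "tower T L d (Suc j) \<subseteq> S \<inter> ?h -` tower T L d j"
      proof
        fix z assume "z \<in> tower T L d (Suc j)"
        then obtain l v where z: "z = (T ^^ k) l + v" "l \<in> L" "v \<in> tower T L d j"
          by (auto simp: k_def elim!: set_plus_elim)
        have "v \<in> range (T ^^ (d - j))" using tower_subset_range[of j d L] z(3) Suc.prems by auto
        then obtain w where w: "v = (T ^^ (d - j)) w" by auto
        have "(T ^^ Suc j) z = (T ^^ d) l + (T ^^ Suc d) w"
          using Suc.prems unfolding z(1) w pow_add pow_pow k_def by (simp add: Suc_diff_le)
        also have "\<dots> = (T ^^ d) (l + T w)" by (simp only: pow_add pow_T)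
        finally have e: "(T ^^ Suc j) z = (T ^^ d) (l + T w)" .
        have "G ((T ^^ Suc j) z) = l"
          unfolding e G using P(4)[OF z(2)] zero[of "T w"] by (simp add: P.add)
        then show "z \<in> S \<inter> ?h -` tower T L d j" using z e by (auto simp: S_def)
      qed
    qed
    finally show ?case .
  qed
qed

lemma closed_csubspace_nilpotent_part:
  assumes W: "closed_csubspace W"
  shows "closed_csubspace (nilpotent_part T W d)"
proof -
  have "closed (ker (T ^^ d))" "closed ((T ^^ k) -` W)" "complex_vector.subspace ((T ^^ k) -` W)" for k
    using W bounded_operator.closed_ker_on[OF power] bounded_operator.closed_vimage[OF power]
      bounded_operator.subspace_vimage[OF power] by (auto simp: closed_csubspace_def)
  then show ?thesis unfolding closed_csubspace_def nilpotent_part_def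
    by (auto intro!: complex_vector.subspace_inter subspace_ker_pow closed_Int closed_INT
      complex_vector.subspace_Inter)
qed

lemma nilpotent_part_invariant:
  assumes "complex_vector.subspace W"
  shows "T ` nilpotent_part T W d \<subseteq> nilpotent_part T W d"
proof
  fix y assume "y \<in> T ` nilpotent_part T W d"
  then obtain x where x: "y = T x" "(T ^^ d) x = 0" "\<And>k. k < d \<Longrightarrow> (T ^^ k) x \<in> W"
    by (auto simp: nilpotent_part_def ker_on_def)
  have "(T ^^ k) y \<in> W" if "k < d" for k
  proof (cases "Suc k = d")
    case True
    then show ?thesis using x complex_vector.subspace_0[OF assms] by (simp only: pow_T x(1))
  next
    case False
    then show ?thesis using that x(3)[of "Suc k"] by (simp only: pow_T x(1))
  qed
  moreover have "(T ^^ d) y = 0" using x(2) by (simp add: x(1) pow_T zero)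
  ultimately show "y \<in> nilpotent_part T W d" by (auto simp: nilpotent_part_def ker_on_def)
qed

text \<open>Downward induction on \<open>i\<close>: if \<open>(T ^^ Suc i) x = 0\<close>, then \<open>(T ^^ i) x\<close> lies both in \<open>W\<close> and
  in \<open>ker T \<inter> range (T ^^ d)\<close>.\<close>

lemma nilpotent_part_range_disjoint:
  assumes W: "(ker T \<inter> range (T ^^ d)) \<inter> W = {0}"
    and x: "x \<in> nilpotent_part T W d" "x \<in> range (T ^^ d)"
  shows "x = 0"
proof -
  have "(T ^^ i) x = 0" if "i \<le> d" for i
    using that
  proof (induction rule: inc_induct)
    case base
    show ?case using x by (simp add: nilpotent_part_def ker_on_def)
  next
    case (step i)
    obtain u where u: "x = (T ^^ d) u" using x by auto
    have "(T ^^ i) x \<in> range (T ^^ d)" unfolding u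
      by (metis pow_pow add.commute rangeI)
    moreover have "(T ^^ i) x \<in> ker T" using step by (simp add: ker_on_def)
    moreover have "(T ^^ i) x \<in> W" using step x by (auto simp: nilpotent_part_def)
    ultimately show ?case using W by auto
  qed
  from this[of 0] show ?thesis by simp
qed

text \<open>The conditions \<open>(T ^^ k) (x - y) \<in> W\<close> are achieved one at a time, from \<open>k = d - 1\<close> downwards. The
  component of \<open>(T ^^ k) (x - y)\<close> along \<open>ker T \<inter> range (T ^^ d)\<close> is \<open>(T ^^ k) z\<close> for some \<open>z\<close> in
  \<open>range (T ^^ d)\<close>, by stability of the kernel; replacing \<open>y\<close> by \<open>y + z\<close> does not affect the
  conditions for higher powers, which annihilate \<open>z\<close>.\<close>

lemma nilpotent_part_covers:
  assumes st: "kernel_stable T d" and sW: "complex_vector.subspace W"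
    and W: "(ker T \<inter> range (T ^^ d)) + W = UNIV"
    and x: "(T ^^ d) x = 0"
  shows "\<exists>y\<in>range (T ^^ d). x - y \<in> nilpotent_part T W d"
proof -
  have "\<exists>y\<in>range (T ^^ d). (T ^^ d) y = 0 \<and> (\<forall>k. d - j \<le> k \<and> k < d \<longrightarrow> (T ^^ k) (x - y) \<in> W)"
    if "j \<le> d" for j
    using that
  proof (induction j)
    case 0
    show ?case using pow_zero by (intro bexI[of _ 0]) (auto, metis rangeI)
  next
    case (Suc j)
    then obtain y where y: "y \<in> range (T ^^ d)" "(T ^^ d) y = 0"
      "\<And>k. d - j \<le> k \<Longrightarrow> k < d \<Longrightarrow> (T ^^ k) (x - y) \<in> W" by auto
    define k where "k = d - Suc j"
    have k: "d - j = Suc k" "Suc k \<le> d" using Suc.prems by (auto simp: k_def)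
    have "(T ^^ k) (x - y) \<in> (ker T \<inter> range (T ^^ d)) + W" using W by simp
    then obtain q w where q: "(T ^^ k) (x - y) = q + w" "q \<in> ker T" "q \<in> range (T ^^ d)" "w \<in> W"
      by (auto elim!: set_plus_elim)
    then have "q \<in> range (T ^^ (k + d))" using st by (auto simp: kernel_stable_def)
    then obtain u where u: "q = (T ^^ k) ((T ^^ d) u)" by (auto simp: pow_pow)
    define z where "z = (T ^^ d) u"
    have z: "(T ^^ i) z = 0" if "Suc k \<le> i" for i
    proof -
      have "(T ^^ (i - Suc k)) (T ((T ^^ k) z)) = 0" using q(2) u by (simp add: ker_on_def z_def pow_zero)
      also have "(T ^^ (i - Suc k)) (T ((T ^^ k) z)) = (T ^^ i) z"
        using that by (simp only: pow_T pow_pow) simp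
      finally show ?thesis .
    qed
    show ?case
    proof (intro bexI[of _ "y + z"] conjI allI impI)
      show "y + z \<in> range (T ^^ d)" using y(1) unfolding z_def
        by (intro complex_vector.subspace_add[OF subspace_range_pow]) auto
      show "(T ^^ d) (y + z) = 0" using z[of d] k y by (simp add: pow_add)
      fix i assume i: "d - Suc j \<le> i \<and> i < d"
      have e: "(T ^^ i) (x - (y + z)) = (T ^^ i) (x - y) - (T ^^ i) z"
        by (simp add: pow_diff pow_add)
      have qz: "(T ^^ k) z = q" using u by (simp add: z_def)
      show "(T ^^ i) (x - (y + z)) \<in> W"
      proof (cases "i = k")
        case True
        then show ?thesis using q(1,4) qz unfolding e by simp
      next
        case False
        then have "Suc k \<le> i" using i by (simp add: k_def)
        then show ?thesis using y(3)[of i] i z[of i] k by (simp add: e)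
      qed
    qed
  qed
  from this[of d] obtain y where "y \<in> range (T ^^ d)" "(T ^^ d) y = 0" "\<forall>k<d. (T ^^ k) (x - y) \<in> W"
    by auto
  then show ?thesis using x by (intro bexI[of _ y]) (auto simp: nilpotent_part_def ker_on_def pow_diff)
qed

text \<open>The decomposition consists of the full tower over a complement \<open>L\<close> of \<open>range T + ker (T ^^ d)\<close>
  and the nilpotent part for a complement \<open>W\<close> of \<open>ker T \<inter> range (T ^^ d)\<close>. On the tower the kernel of
  \<open>T\<close> is \<open>ker T \<inter> range (T ^^ d)\<close>, with complement cut out by \<open>W\<close>, and the range is the trace of
  \<open>range T + ker (T ^^ d)\<close>, with complement \<open>L\<close>.\<close>

theorem Saphar_type_of_complemented:
  assumes st: "kernel_stable T d" and cd: "closed (range (T ^^ d))"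
    and Rc: "top_complemented_in UNIV (range T + ker (T ^^ d))"
    and Kc: "top_complemented_in UNIV (ker T \<inter> range (T ^^ d))"
  shows "Saphar_type T"
proof -
  let ?S = "range T + ker (T ^^ d)" and ?K = "ker T \<inter> range (T ^^ d)"
  obtain L where S: "closed_csubspace ?S" and L: "closed_csubspace L" and "direct_sum UNIV ?S L"
    using Rc by (auto simp: top_complemented_in_def)
  then have ds: "direct_sum UNIV L ?S" and LS: "L + ?S = UNIV" and LS0: "L \<inter> ?S = {0}"
    by (auto simp: direct_sum_def add.commute Int_commute)
  obtain W where K: "closed_csubspace ?K" and W: "closed_csubspace W" and "direct_sum UNIV ?K W"
    using Kc by (auto simp: top_complemented_in_def)
  then have KW: "?K + W = UNIV" and KW0: "?K \<inter> W = {0}"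
    by (auto simp: direct_sum_def)
  have sL: "complex_vector.subspace L" and sW: "complex_vector.subspace W"
    and sK: "complex_vector.subspace ?K" and sS: "complex_vector.subspace ?S"
    using L W K S by (auto simp: closed_csubspace_def)
  define M where "M = tower T L d d"
  define N where "N = nilpotent_part T W d"
  have sM: "complex_vector.subspace M" unfolding M_def by (rule subspace_tower[OF sL])
  have M: "closed_csubspace M" using closed_tower[OF cd L S ds, of d] sM
    by (simp add: closed_csubspace_def M_def)
  have N: "closed_csubspace N" unfolding N_def by (rule closed_csubspace_nilpotent_part[OF W])
  have sN: "complex_vector.subspace N" using N by (simp add: closed_csubspace_def)
  have TM: "T ` M \<subseteq> M" unfolding M_def by (rule tower_invariant[OF LS sL])
  have TN: "T ` N \<subseteq> N" unfolding N_def by (rule nilpotent_part_invariant[OF sW])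
  have RM: "range (T ^^ d) \<subseteq> M" unfolding M_def by (rule range_subset_tower[OF sL])
  have "M \<inter> N \<subseteq> {0}"
  proof
    fix x assume x: "x \<in> M \<inter> N"
    then have "(T ^^ d) x = 0" by (simp add: N_def nilpotent_part_def ker_on_def)
    then have "x \<in> range (T ^^ d)" using tower_ker[OF st sL LS0, of d x d] x by (simp add: M_def)
    then show "x \<in> {0}" using nilpotent_part_range_disjoint[OF KW0] x by (auto simp: N_def)
  qed
  moreover have "x \<in> M + N" for x
  proof -
    have "x \<in> M + ker (T ^^ d)" using tower_covers[OF LS, of d] by (auto simp: M_def)
    then obtain m n where mn: "x = m + n" "m \<in> M" "(T ^^ d) n = 0"
      by (auto simp: ker_on_def elim!: set_plus_elim)
    obtain y where "y \<in> range (T ^^ d)" "n - y \<in> N"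
      using nilpotent_part_covers[OF st sW KW mn(3)] by (auto simp: N_def)
    then have "(m + y) + (n - y) \<in> M + N"
      using RM mn(2) by (intro set_plus_intro complex_vector.subspace_add[OF sM]) auto
    then show ?thesis by (simp add: mn(1))
  qed
  ultimately have dMN: "direct_sum UNIV M N"
    using complex_vector.subspace_0[OF sM] complex_vector.subspace_0[OF sN] sM sN
    by (auto simp: direct_sum_def)
  have red: "(M, N) \<in> Red T" using M N TM TN dMN by (simp add: Red_def)
  have LM: "L \<subseteq> M" and imM: "T ` M = M \<inter> ?S"
  proof -
    have "T ` M \<subseteq> M \<inter> ?S"
    proof -
      have "T x + 0 \<in> ?S" for x
        using complex_vector.subspace_0[OF subspace_ker_pow] by (intro set_plus_intro) auto
      then show ?thesis using TM by auto
    qed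
    moreover have "L \<subseteq> M \<and> M \<inter> ?S \<subseteq> T ` M"
    proof (cases d)
      case 0
      then show ?thesis by (auto simp: M_def ker_on_def set_plus_def)
    next
      case (Suc e)
      have Me: "M = L + T ` M" using image_tower[OF LS, of e] Suc by (simp add: M_def)
      have sTM: "complex_vector.subspace (T ` M)" by (rule subspace_image[OF sM])
      have "L \<subseteq> L + T ` M" using complex_vector.subspace_0[OF sTM] by (force simp: set_plus_def)
      moreover have "x \<in> T ` M" if x: "x \<in> M" "x \<in> ?S" for x
      proof -
        obtain l v where lv: "x = l + v" "l \<in> L" "v \<in> T ` M" using x(1) Me by (metis set_plus_elim)
        have "v \<in> ?S" using \<open>T ` M \<subseteq> M \<inter> ?S\<close> lv(3) by blast
        then have "x - v \<in> ?S" using x(2) complex_vector.subspace_diff[OF sS] by blast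
        then have "l = 0" using LS0 lv by auto
        then show ?thesis using lv by simp
      qed
      ultimately show ?thesis using Me by blast
    qed
    ultimately show "L \<subseteq> M" "T ` M = M \<inter> ?S" by auto
  qed
  have kerM: "ker_on M T = ?K"
  proof
    show "ker_on M T \<subseteq> ?K"
      using tower_ker[OF st sL LS0, of d _ 1] by (auto simp: ker_on_def M_def)
    show "?K \<subseteq> ker_on M T" using RM by (auto simp: ker_on_def)
  qed
  have cTM: "closed_csubspace (T ` M)"
    unfolding imM using M S by (auto simp: closed_csubspace_def intro: complex_vector.subspace_inter)
  have "Kato_on M T"
    unfolding Kato_on_def
  proof (intro conjI allI)
    show "closed (T ` M)" using cTM by (simp add: closed_csubspace_def)
    fix n
    show "ker_on M T \<subseteq> (T ^^ n) ` M"
    proof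
      fix x assume "x \<in> ker_on M T"
      then have "x \<in> range (T ^^ (n + d))" using st kerM by (auto simp: kernel_stable_def)
      then obtain u where "x = (T ^^ n) ((T ^^ d) u)" by (auto simp: pow_pow)
      then show "x \<in> (T ^^ n) ` M" using RM by auto
    qed
  qed
  moreover have "top_complemented_in M (ker_on M T)"
  proof -
    have "x \<in> ?K + (W \<inter> M)" if x: "x \<in> M" for x
    proof -
      have "x \<in> ?K + W" using KW by simp
      then obtain k w where kw: "x = k + w" "k \<in> ?K" "w \<in> W" by (rule set_plus_elim)
      then have "x - k \<in> M" using complex_vector.subspace_diff[OF sM x] RM by blast
      then show ?thesis using kw by (auto intro: set_plus_intro)
    qed
    moreover have "?K + (W \<inter> M) \<subseteq> M"
      using RM by (intro plus_subset_csubspace[OF sM]) auto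
    ultimately have "?K + (W \<inter> M) = M" by blast
    moreover have "?K \<inter> (W \<inter> M) = {0}" using KW0 complex_vector.subspace_0[OF sM] by blast
    moreover have "closed_csubspace (W \<inter> M)"
      using W M by (auto simp: closed_csubspace_def intro: complex_vector.subspace_inter)
    ultimately show ?thesis unfolding kerM top_complemented_in_def direct_sum_def
      using K sK by (auto simp: closed_csubspace_def)
  qed
  moreover have "top_complemented_in M (T ` M)"
  proof -
    have "x \<in> T ` M + L" if x: "x \<in> M" for x
    proof -
      have "x \<in> L + ?S" using LS by simp
      then obtain l s where ls: "x = l + s" "l \<in> L" "s \<in> ?S" by (rule set_plus_elim)
      have "x - l \<in> M" using complex_vector.subspace_diff[OF sM x] LM ls(2) by blast
      then have "s \<in> T ` M" using ls imM by simp
      then have "s + l \<in> T ` M + L" using ls(2) by (rule set_plus_intro)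
      then show ?thesis by (simp add: ls(1) add.commute)
    qed
    moreover have "T ` M + L \<subseteq> M"
      by (rule plus_subset_csubspace[OF sM TM LM])
    ultimately have "T ` M + L = M" by blast
    moreover have "T ` M \<inter> L = {0}"
      unfolding imM using LS0 complex_vector.subspace_0[OF sM] by blast
    ultimately show ?thesis unfolding top_complemented_in_def direct_sum_def
      using cTM L by (auto simp: closed_csubspace_def)
  qed
  ultimately have "Saphar_on M T" by (simp add: Saphar_on_def relatively_regular_on_def)
  moreover have "nilpotent_on N T"
    by (auto simp: nilpotent_on_def N_def nilpotent_part_def ker_on_def)
  ultimately show ?thesis using red by (auto simp: Saphar_type_def)
qed

end

section \<open>Complements from decompositions of Saphar type\<close>

lemma direct_sum_commute: "direct_sum X M N \<Longrightarrow> direct_sum X N M"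
  by (auto simp: direct_sum_def add.commute Int_commute)

lemma direct_sum_right_subset:
  assumes "direct_sum X M N"
  shows "N \<subseteq> X"
proof
  fix n assume "n \<in> N"
  moreover have "0 \<in> M" using assms by (simp add: direct_sum_def complex_vector.subspace_0)
  ultimately have "0 + n \<in> M + N" by (intro set_plus_intro)
  then show "n \<in> X" using assms by (simp add: direct_sum_def)
qed

lemma direct_sum_unique:
  assumes "direct_sum X M N" "m \<in> M" "n \<in> N" "m' \<in> M" "n' \<in> N" "m + n = m' + n'"
  shows "m = m'" "n = n'"
proof -
  have sM: "complex_vector.subspace M" and sN: "complex_vector.subspace N" and i: "M \<inter> N = {0}"
    using assms(1) by (auto simp: direct_sum_def)
  have e: "m - m' = n' - n" using assms(6) by (simp add: algebra_simps)
  have "m - m' \<in> M" using complex_vector.subspace_diff[OF sM assms(2,4)] .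
  moreover have "m - m' \<in> N" unfolding e using complex_vector.subspace_diff[OF sN assms(5,3)] .
  ultimately have "m - m' = 0" using i by blast
  then show "m = m'" "n = n'" using e by auto
qed

text \<open>Splitting one summand of a direct sum further and regrouping.\<close>

lemma direct_sum_refine:
  assumes MN: "direct_sum X M N" and AW: "direct_sum M A W"
  shows "direct_sum X (A + N) W" "direct_sum X A (W + N)"
proof -
  have main: "direct_sum X (A + N) W" if AW: "direct_sum M A W" for A W
  proof -
    have s: "complex_vector.subspace N" "complex_vector.subspace A" "complex_vector.subspace W"
      and AWM: "A + W = M" and MNX: "M + N = X" and AW0: "A \<inter> W = {0}"
      using MN AW by (auto simp: direct_sum_def)
    have AM: "a + w \<in> M" if "a \<in> A" "w \<in> W" for a w using AWM that by (auto intro: set_plus_intro)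
    have z: "0 \<in> A" "0 \<in> N" "0 \<in> W" using s by (auto intro: complex_vector.subspace_0)
    have "(A + N) \<inter> W \<subseteq> {0}"
    proof
      fix x assume "x \<in> (A + N) \<inter> W"
      then obtain a n where x: "x = a + n" "a \<in> A" "n \<in> N" "x \<in> W" by (auto elim!: set_plus_elim)
      have "x + 0 = a + n" using x by simp
      from direct_sum_unique[OF MN _ z(2) _ x(3) this] have "x = a"
        using AM[OF z(1) x(4)] AM[OF x(2) z(3)] by simp
      then show "x \<in> {0}" using x AW0 by blast
    qed
    moreover have "0 \<in> (A + N) \<inter> W" using set_plus_intro[OF z(1,2)] z(3) by simp
    moreover have "(A + N) + W = X" unfolding MNX[symmetric] AWM[symmetric]
      by (simp add: add.assoc add.commute[of N])
    ultimately show ?thesis using csubspace_plus[OF s(2,1)] s(3) by (auto simp: direct_sum_def)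
  qed
  show "direct_sum X (A + N) W" by (rule main[OF AW])
  show "direct_sum X A (W + N)"
    by (rule direct_sum_commute[OF main[OF direct_sum_commute[OF AW]]])
qed


context bounded_operator
begin

lemma invariant_pow: "T ` M \<subseteq> M \<Longrightarrow> x \<in> M \<Longrightarrow> (T ^^ n) x \<in> M"
  by (induction n) auto

lemma Red_D:
  assumes "(M, N) \<in> Red T"
  shows "closed_csubspace M" "closed_csubspace N" "T ` M \<subseteq> M" "T ` N \<subseteq> N" "direct_sum UNIV M N"
    "complex_vector.subspace M" "complex_vector.subspace N" "closed M" "closed N" "M \<inter> N = {0}"
  using assms by (auto simp: Red_def closed_csubspace_def direct_sum_def)

lemma Red_split:
  assumes "(M, N) \<in> Red T"
  shows "\<exists>m\<in>M. \<exists>n\<in>N. x = m + n"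
proof -
  have "x \<in> M + N" using assms by (simp add: Red_def direct_sum_def)
  then show ?thesis by (auto elim!: set_plus_elim)
qed

lemma Red_pow_eq_0:
  assumes red: "(M, N) \<in> Red T" and "m \<in> M" "n \<in> N" "(T ^^ k) (m + n) = 0"
  shows "(T ^^ k) m = 0" "(T ^^ k) n = 0"
proof -
  note R = Red_D[OF red]
  have "(T ^^ k) m + (T ^^ k) n = 0 + 0" using assms(4) by (simp add: pow_add)
  from direct_sum_unique[OF R(5) _ _ _ _ this]
  show "(T ^^ k) m = 0" "(T ^^ k) n = 0"
    using invariant_pow[OF R(3) assms(2)] invariant_pow[OF R(4) assms(3)]
      complex_vector.subspace_0[OF R(6)] complex_vector.subspace_0[OF R(7)] by blast+
qed

lemma Red_image_pow:
  assumes red: "(M, N) \<in> Red T"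
  shows "(T ^^ k) ` N = range (T ^^ k) \<inter> N"
proof
  note R = Red_D[OF red]
  show "(T ^^ k) ` N \<subseteq> range (T ^^ k) \<inter> N" using invariant_pow[OF R(4)] by auto
  show "range (T ^^ k) \<inter> N \<subseteq> (T ^^ k) ` N"
  proof
    fix y assume y: "y \<in> range (T ^^ k) \<inter> N"
    then obtain x where x: "y = (T ^^ k) x" by auto
    obtain m n where mn: "m \<in> M" "n \<in> N" "x = m + n" using Red_split[OF red] by blast
    have "0 + y = (T ^^ k) m + (T ^^ k) n" by (simp add: x mn(3) pow_add)
    from direct_sum_unique(2)[OF R(5) _ _ _ _ this]
    have "y = (T ^^ k) n"
      using y invariant_pow[OF R(3) mn(1)] invariant_pow[OF R(4) mn(2)]
        complex_vector.subspace_0[OF R(6)] by blast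
    then show "y \<in> (T ^^ k) ` N" using mn(2) by blast
  qed
qed

text \<open>The converse. High powers of \<open>T\<close> have range in the Saphar part \<open>M\<close>, so by stability
  \<open>ker T \<inter> range (T ^^ d)\<close> is the kernel of \<open>T\<close> on \<open>M\<close>, and \<open>T ^^ d\<close> already vanishes on \<open>N\<close>. The Kato
  property then gives \<open>range T + ker (T ^^ d) = T ` M + N\<close>. Complements inside \<open>M\<close>, enlarged by \<open>N\<close>
  where necessary, are complements in the whole space.\<close>

theorem complemented_of_Saphar_type:
  assumes st: "kernel_stable T d" and "Saphar_type T"
  shows "top_complemented_in UNIV (ker T \<inter> range (T ^^ d))"
    "top_complemented_in UNIV (range T + ker (T ^^ d))"
proof -
  obtain M N where red: "(M, N) \<in> Red T" and sa: "Saphar_on M T" and "nilpotent_on N T"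
    using assms(2) by (auto simp: Saphar_type_def)
  then obtain p where p: "\<And>x. x \<in> N \<Longrightarrow> (T ^^ p) x = 0" by (auto simp: nilpotent_on_def)
  note R = Red_D[OF red]
  have range_p: "range (T ^^ p) \<subseteq> M"
  proof
    fix y assume "y \<in> range (T ^^ p)"
    then obtain x where x: "y = (T ^^ p) x" by auto
    obtain m n where "m \<in> M" "n \<in> N" "x = m + n" using Red_split[OF red] by blast
    then show "y \<in> M" using p invariant_pow[OF R(3)] by (simp add: x pow_add)
  qed
  have Kato: "\<And>n. ker_on M T \<subseteq> (T ^^ n) ` M" and
    reg: "top_complemented_in M (ker_on M T)" "top_complemented_in M (T ` M)"
    using sa by (auto simp: Saphar_on_def Kato_on_def relatively_regular_on_def)
  have K: "ker T \<inter> range (T ^^ d) = ker_on M T"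
  proof
    have "ker T \<inter> range (T ^^ d) \<subseteq> range (T ^^ p)" using st by (simp add: kernel_stable_def)
    then show "ker T \<inter> range (T ^^ d) \<subseteq> ker_on M T" using range_p by (auto simp: ker_on_def)
    show "ker_on M T \<subseteq> ker T \<inter> range (T ^^ d)" using Kato[of d] by (auto simp: ker_on_def)
  qed
  have N0: "(T ^^ d) x = 0" if x: "x \<in> N" for x
  proof -
    have "(T ^^ p) ((T ^^ d) x) = 0" using p invariant_pow[OF R(4) x] by blast
    then have "(T ^^ d) x \<in> range (T ^^ p)" by (rule kernel_stable_pow[OF st rangeI])
    then show ?thesis using range_p invariant_pow[OF R(4) x] R(10) by blast
  qed
  have S: "range T + ker (T ^^ d) = T ` M + N"
  proof
    have sS: "complex_vector.subspace (T ` M + N)"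
      by (intro csubspace_plus subspace_image R)
    have TN: "T ` M \<subseteq> T ` M + N" "N \<subseteq> T ` M + N"
      using complex_vector.subspace_0[OF R(7)] complex_vector.subspace_0[OF subspace_image[OF R(6)]]
      by (force simp: set_plus_def)+
    show "range T + ker (T ^^ d) \<subseteq> T ` M + N"
    proof (rule plus_subset_csubspace[OF sS])
      show "range T \<subseteq> T ` M + N"
      proof
        fix y assume "y \<in> range T"
        then obtain x where x: "y = T x" by auto
        obtain m n where mn: "m \<in> M" "n \<in> N" "x = m + n" using Red_split[OF red] by blast
        have "T m + T n \<in> T ` M + N" using mn R(4) by (intro set_plus_intro) auto
        then show "y \<in> T ` M + N" by (simp add: x mn(3) add)
      qed
      show "ker (T ^^ d) \<subseteq> T ` M + N"
      proof
        fix x assume x: "x \<in> ker (T ^^ d)"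
        obtain m n where mn: "m \<in> M" "n \<in> N" "x = m + n" using Red_split[OF red] by blast
        have "(T ^^ d) m = 0" using Red_pow_eq_0(1)[OF red mn(1,2)] x mn(3) by (simp add: ker_on_def)
        from ker_pow_subset_image_pow[OF R(6,3) Kato mn(1) this, of 1]
        have "m \<in> T ` M" by simp
        then show "x \<in> T ` M + N" using mn by (simp add: set_plus_intro)
      qed
    qed
    show "T ` M + N \<subseteq> range T + ker (T ^^ d)"
      by (rule set_plus_mono2) (use N0 in \<open>auto simp: ker_on_def\<close>)
  qed
  obtain W where W: "closed_csubspace (ker_on M T)" "closed_csubspace W" "direct_sum M (ker_on M T) W"
    using reg(1) by (auto simp: top_complemented_in_def)
  obtain W' where W': "closed_csubspace (T ` M)" "closed_csubspace W'" "direct_sum M (T ` M) W'"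
    using reg(2) by (auto simp: top_complemented_in_def)
  have "W \<subseteq> M" by (rule direct_sum_right_subset[OF W(3)])
  then have "closed (W + N)"
    using W(2) by (intro closed_plus_of_direct_sum[OF R(1,2,5)] R) (auto simp: closed_csubspace_def)
  moreover have "complex_vector.subspace (W + N)"
    using W(2) by (intro csubspace_plus R) (simp add: closed_csubspace_def)
  moreover have "direct_sum UNIV (ker_on M T) (W + N)" by (rule direct_sum_refine(2)[OF R(5) W(3)])
  ultimately show "top_complemented_in UNIV (ker T \<inter> range (T ^^ d))"
    unfolding K using W(1) by (auto simp: top_complemented_in_def closed_csubspace_def)
  have "closed (T ` M + N)"
    using W'(1) by (intro closed_plus_of_direct_sum[OF R(1,2,5)] R) (auto simp: closed_csubspace_def)
  moreover have "complex_vector.subspace (T ` M + N)"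
    using W'(1) by (intro csubspace_plus R) (simp add: closed_csubspace_def)
  moreover have "direct_sum UNIV (T ` M + N) W'" by (rule direct_sum_refine(1)[OF R(5) W'(3)])
  ultimately show "top_complemented_in UNIV (range T + ker (T ^^ d))"
    unfolding S using W'(2) by (auto simp: top_complemented_in_def closed_csubspace_def)
qed

end

section \<open>Meromorphic summands\<close>

context bounded_operator
begin

text \<open>An eigenvector for the eigenvalue \<open>0\<close> of a Kato operator deforms to approximate eigenvectors for
  every small \<open>z\<close>. Starting from \<open>a 0 = x\<close>, choose \<open>a (Suc k)\<close> with \<open>T (a (Suc k)) = a k\<close> and norms
  growing at most geometrically; the partial sums \<open>s n\<close> of \<open>z ^ k *\<^sub>C a k\<close> satisfy
  \<open>z *\<^sub>C s n - T (s n) = z *\<^sub>C z ^ n *\<^sub>C a n\<close>, which tends to \<open>0\<close>, while \<open>s n\<close> stays close to \<open>x\<close>. If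
  \<open>z - T\<close> is bounded below for such a \<open>z\<close>, then \<open>x = 0\<close>.\<close>

lemma ker_trivial_of_small_regular_points:
  assumes Y: "complex_vector.subspace Y" "closed Y" "T ` Y \<subseteq> Y" and cl: "closed (T ` Y)"
    and ker: "\<And>n. ker_on Y T \<subseteq> (T ^^ n) ` Y"
    and small: "\<And>e. e > 0 \<Longrightarrow> \<exists>z c. cmod z < e \<and> (\<forall>x\<in>Y. norm x \<le> c * norm (z *\<^sub>C x - T x))"
    and x: "x \<in> Y" "T x = 0"
  shows "x = 0"
proof -
  obtain C where C: "C > 0" "\<And>y. y \<in> T ` Y \<Longrightarrow> \<exists>x\<in>Y. T x = y \<and> norm x \<le> C * norm y"
    using open_mapping_bound[OF bl csubspace_imp_subspace[OF Y(1)] Y(2) cl] by blast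
  then have "\<forall>y\<in>T ` Y. \<exists>x. x \<in> Y \<and> T x = y \<and> norm x \<le> C * norm y" by blast
  from bchoice[OF this] obtain h where h: "\<And>y. y \<in> T ` Y \<Longrightarrow> h y \<in> Y"
    "\<And>y. y \<in> T ` Y \<Longrightarrow> T (h y) = y" "\<And>y. y \<in> T ` Y \<Longrightarrow> norm (h y) \<le> C * norm y"
    by blast
  \<comment> \<open>The chain never leaves \<open>T ` Y\<close>, since its members are annihilated by powers of \<open>T\<close>.\<close>
  define a where "a k = (h ^^ k) x" for k
  have a0: "a 0 = x" and aS: "a (Suc k) = h (a k)" for k by (simp_all add: a_def)
  have aY: "a k \<in> Y \<and> (T ^^ Suc k) (a k) = 0" for k
  proof (induction k)
    case 0
    show ?case using x by (simp add: a0)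
  next
    case (Suc k)
    have "a k \<in> T ` Y"
      using ker_pow_subset_image_pow[OF Y(1,3) ker, of "a k" "Suc k" 1] Suc by simp
    then have "h (a k) \<in> Y" "(T ^^ Suc k) (T (h (a k))) = 0" using h Suc by auto
    then show ?case by (simp only: aS pow_T)
  qed
  have aT: "a k \<in> T ` Y" for k
    using ker_pow_subset_image_pow[OF Y(1,3) ker, of "a k" "Suc k" 1] aY[of k] by simp
  have Ta: "T (a (Suc k)) = a k" for k by (simp add: aS h aT)
  have an: "norm (a k) \<le> C ^ k * norm x" for k
  proof (induction k)
    case (Suc k)
    have "norm (a (Suc k)) \<le> C * norm (a k)" by (simp add: aS h aT)
    also have "\<dots> \<le> C * (C ^ k * norm x)" using Suc C(1) by (intro mult_left_mono) auto
    finally show ?case by simp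
  qed (simp add: a0)
  \<comment> \<open>The bound makes the ratio of the geometric series at most \<open>1/4\<close>, so that \<open>s n\<close> stays within
    \<open>norm x / 3\<close> of \<open>x\<close>.\<close>
  obtain z c where z: "cmod z < 1 / (4 * C)" and c: "\<And>x. x \<in> Y \<Longrightarrow> norm x \<le> c * norm (z *\<^sub>C x - T x)"
    using small[of "1 / (4 * C)"] C(1) by auto
  have zC: "cmod z * C \<le> 1/4" using z C(1) by (simp add: field_simps)
  have term_le: "norm (z ^ k *\<^sub>C a k) \<le> (1/4) ^ k * norm x" for k
  proof -
    have "norm (z ^ k *\<^sub>C a k) \<le> cmod z ^ k * (C ^ k * norm x)"
      unfolding norm_scaleC norm_power by (intro mult_left_mono an) auto
    also have "\<dots> = (cmod z * C) ^ k * norm x" by (simp add: power_mult_distrib)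
    also have "\<dots> \<le> (1/4) ^ k * norm x"
      using C(1) by (intro mult_right_mono power_mono zC) auto
    finally show ?thesis .
  qed
  define s where "s n = (\<Sum>k\<le>n. z ^ k *\<^sub>C a k)" for n
  have s0: "s 0 = x" and sS: "s (Suc n) = s n + z ^ Suc n *\<^sub>C a (Suc n)" for n
    by (simp_all add: s_def a0)
  have sY: "s n \<in> Y" for n
    unfolding s_def using aY
    by (intro complex_vector.subspace_sum[OF Y(1)] complex_vector.subspace_scale[OF Y(1)]) auto
  have telescope: "z *\<^sub>C s n - T (s n) = z *\<^sub>C z ^ n *\<^sub>C a n" for n
  proof (induction n)
    case 0
    show ?case using x by (simp add: s0 a0)
  next
    case (Suc n)
    have "z *\<^sub>C s (Suc n) - T (s (Suc n)) =
        (z *\<^sub>C s n - T (s n)) + (z *\<^sub>C z ^ Suc n *\<^sub>C a (Suc n) - z ^ Suc n *\<^sub>C a n)"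
      by (simp only: sS add scaleC Ta scaleC_add_right) (simp only: algebra_simps)
    also have "z *\<^sub>C s n - T (s n) = z ^ Suc n *\<^sub>C a n" by (simp add: Suc scaleC_scaleC)
    finally show ?case by simp
  qed
  have "norm (s n - x) \<le> (1/3) * (1 - (1/4) ^ n) * norm x" for n
  proof (induction n)
    case (Suc n)
    have "norm (s (Suc n) - x) \<le> norm (s n - x) + norm (z ^ Suc n *\<^sub>C a (Suc n))"
      unfolding sS by (metis add_diff_eq add.commute norm_triangle_ineq)
    also have "\<dots> \<le> (1/3) * (1 - (1/4) ^ n) * norm x + (1/4) ^ Suc n * norm x"
      by (intro add_mono Suc term_le)
    also have "\<dots> = (1/3) * (1 - (1/4) ^ Suc n) * norm x" by (simp add: algebra_simps)
    finally show ?case .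
  qed (simp add: s0)
  moreover have "(1/3) * (1 - (1/4) ^ n) * norm x \<le> (1/3) * norm x" for n :: nat
    by (intro mult_right_mono) auto
  ultimately have near: "norm (s n - x) \<le> (1/3) * norm x" for n by (meson order.trans)
  have c0: "norm (s n) \<le> \<bar>c\<bar> * cmod z * norm x * (1/4) ^ n" for n
  proof -
    have "norm (s n) \<le> c * norm (z *\<^sub>C z ^ n *\<^sub>C a n)" using c[OF sY] telescope by metis
    also have "\<dots> \<le> \<bar>c\<bar> * norm (z *\<^sub>C z ^ n *\<^sub>C a n)" by (intro mult_right_mono) auto
    also have "\<dots> \<le> \<bar>c\<bar> * (cmod z * ((1/4) ^ n * norm x))"
      unfolding norm_scaleC[of z] by (intro mult_left_mono term_le) auto
    finally show ?thesis by (simp add: mult_ac)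
  qed
  have "(2/3) * norm x \<le> \<bar>c\<bar> * cmod z * norm x * (1/4) ^ n" for n
    using near[of n] c0[of n] norm_triangle_ineq2[of x "s n"] by (simp add: norm_minus_commute)
  moreover have "(\<lambda>n. \<bar>c\<bar> * cmod z * norm x * (1/4::real) ^ n) \<longlonglongrightarrow> \<bar>c\<bar> * cmod z * norm x * 0"
    by (intro tendsto_intros LIMSEQ_power_zero) auto
  ultimately have "(2/3) * norm x \<le> \<bar>c\<bar> * cmod z * norm x * 0"
    by (intro LIMSEQ_le_const) auto
  then show "x = 0" by simp
qed

text \<open>An injective operator with closed range is bounded below, so the solutions of
  \<open>z *\<^sub>C x - T x = y\<close> are bounded uniformly for small \<open>z\<close>, and \<open>T (- x)\<close> tends to \<open>y\<close> as \<open>z\<close> tends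
  to \<open>0\<close>.\<close>

lemma surjective_of_small_regular_points:
  assumes Y: "complex_vector.subspace Y" "closed Y" and cl: "closed (T ` Y)"
    and inj: "\<And>x. x \<in> Y \<Longrightarrow> T x = 0 \<Longrightarrow> x = 0"
    and small: "\<And>e. e > 0 \<Longrightarrow> \<exists>z. cmod z < e \<and> Y \<subseteq> (\<lambda>x. z *\<^sub>C x - T x) ` Y"
  shows "Y \<subseteq> T ` Y"
proof
  fix y assume y: "y \<in> Y"
  obtain C where C: "C > 0" "\<And>y. y \<in> T ` Y \<Longrightarrow> \<exists>x\<in>Y. T x = y \<and> norm x \<le> C * norm y"
    using open_mapping_bound[OF bl csubspace_imp_subspace[OF Y(1)] Y(2) cl] by blast
  have below: "norm x \<le> C * norm (T x)" if x: "x \<in> Y" for x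
  proof -
    obtain x' where x': "x' \<in> Y" "T x' = T x" "norm x' \<le> C * norm (T x)" using C(2) x by blast
    have "x' - x = 0"
      by (rule inj) (use x' x complex_vector.subspace_diff[OF Y(1)] in \<open>simp_all add: diff\<close>)
    then show ?thesis using x' by simp
  qed
  have "\<exists>v\<in>T ` Y. dist v y < e" if e: "e > 0" for e
  proof -
    \<comment> \<open>The first bound gives \<open>norm x \<le> 2 C norm y\<close>, the second then makes \<open>z *\<^sub>C x\<close> smaller than \<open>e\<close>.\<close>
    define b where "b = min (1 / (2 * C)) (e / (2 * C * (norm y + 1)))"
    have "2 * C * (norm y + 1) > 0"
      using C(1) by (intro mult_pos_pos add_nonneg_pos) auto
    then have "b > 0" using C(1) e by (auto simp: b_def intro: divide_pos_pos)
    then obtain z where z: "cmod z < b" "Y \<subseteq> (\<lambda>x. z *\<^sub>C x - T x) ` Y" using small by blast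
    then obtain x where x: "x \<in> Y" "y = z *\<^sub>C x - T x" using y by blast
    have "C * (cmod z * norm x) \<le> norm x / 2"
    proof -
      have "C * cmod z \<le> 1/2" using z(1) C(1) by (simp add: b_def field_simps)
      from mult_right_mono[OF this, of "norm x"] show ?thesis by (simp add: mult.assoc)
    qed
    moreover have "norm (T x) \<le> norm y + cmod z * norm x"
    proof -
      have "T x = z *\<^sub>C x - y" using x by simp
      then show ?thesis using norm_triangle_ineq4[of "z *\<^sub>C x" y] by (simp add: norm_scaleC)
    qed
    then have "C * norm (T x) \<le> C * norm y + C * (cmod z * norm x)"
      using C(1) by (metis distrib_left mult_left_mono less_imp_le)
    ultimately have nx: "norm x \<le> 2 * C * norm y" using below[OF x(1)] by linarith
    have "dist (T (- x)) y = cmod z * norm x"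
      by (simp add: x(2) dist_norm neg norm_scaleC)
    also have "\<dots> \<le> cmod z * (2 * C * norm y)" by (intro mult_left_mono nx) auto
    also have "\<dots> \<le> cmod z * (2 * C * (norm y + 1))"
      using C(1) by (intro mult_left_mono) auto
    also have "\<dots> < e"
    proof -
      have "cmod z < e / (2 * C * (norm y + 1))" using z(1) by (simp add: b_def)
      moreover have "2 * C * (norm y + 1) > 0" using C(1) by (intro mult_pos_pos add_nonneg_pos) auto
      ultimately show ?thesis by (simp only: pos_less_divide_eq)
    qed
    finally show ?thesis using complex_vector.subspace_neg[OF Y(1) x(1)] by blast
  qed
  then have "y \<in> closure (T ` Y)" by (auto simp: closure_approachable)
  then show "y \<in> T ` Y" using cl by simp
qed

end

lemma bounded_linear_scaleC: "bounded_linear (\<lambda>x. c *\<^sub>C x)" for c :: complex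
proof (rule bounded_linear_intro[of _ "cmod c"])
  fix r :: real and x :: 'a
  show "c *\<^sub>C (r *\<^sub>R x) = r *\<^sub>R (c *\<^sub>C x)"
    by (simp add: scaleC_scaleC mult.commute flip: scaleC_of_real)
qed (simp_all add: scaleC_add_right norm_scaleC)

lemma mem_spectrum_on_lower_bound:
  assumes "z \<notin> spectrum_on N T" "\<And>x. x \<in> N \<Longrightarrow> z *\<^sub>C x - T x \<in> N"
  shows "\<exists>c. \<forall>x\<in>N. norm x \<le> c * norm (z *\<^sub>C x - T x)"
    and "(\<lambda>x. z *\<^sub>C x - T x) ` N = N"
proof -
  obtain S where S: "bounded_op_on N S" "\<And>x. x \<in> N \<Longrightarrow> S (z *\<^sub>C x - T x) = x"
    "\<And>x. x \<in> N \<Longrightarrow> z *\<^sub>C S x - T (S x) = x"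
    using assms(1) by (auto simp: spectrum_on_def invertible_on_def)
  obtain K where K: "\<And>x. x \<in> N \<Longrightarrow> norm (S x) \<le> norm x * K"
    using S(1) unfolding bounded_op_on_def by blast
  have "norm x \<le> K * norm (z *\<^sub>C x - T x)" if "x \<in> N" for x
    using K[OF assms(2)[OF that]] S(2)[OF that] by (simp add: mult.commute)
  then show "\<exists>c. \<forall>x\<in>N. norm x \<le> c * norm (z *\<^sub>C x - T x)" by blast
  have "y \<in> (\<lambda>x. z *\<^sub>C x - T x) ` N" if "y \<in> N" for y
    using S(1) S(3)[OF that] that by (intro image_eqI[of _ _ "S y"]) (auto simp: bounded_op_on_def)
  then show "(\<lambda>x. z *\<^sub>C x - T x) ` N = N" using assms(2) by auto
qed

text \<open>All that is used of meromorphic operators: if \<open>e / 2\<close> itself lies in the spectrum, it is a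
  pole, and the spectrum has no other points nearby.\<close>

lemma meromorphic_small_regular_point:
  assumes "meromorphic_op_on N T" "e > 0"
  shows "\<exists>z. cmod z < e \<and> z \<notin> spectrum_on N T"
proof (cases "complex_of_real (e/2) \<in> spectrum_on N T")
  case False
  then show ?thesis using assms(2) by (intro exI[of _ "complex_of_real (e/2)"]) (simp del: of_real_divide)
next
  case True
  let ?w = "complex_of_real (e/2)"
  have "?w \<noteq> 0" using assms(2) by simp
  then have "resolvent_pole_on N T ?w" using True assms(1) unfolding meromorphic_op_on_def by blast
  then obtain r where r: "r > 0" "\<And>z. 0 < cmod (z - ?w) \<Longrightarrow> cmod (z - ?w) < r \<Longrightarrow> z \<notin> spectrum_on N T"
    unfolding resolvent_pole_on_def by blast
  define t where "t = min r (e/2) / 2"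
  have t: "0 < t" "t < r" "t < e/2" using r assms(2) by (auto simp: t_def)
  have "cmod (complex_of_real (e/2 + t)) < e" using t assms(2) by (simp only: norm_of_real)
  moreover have "complex_of_real (e/2 + t) \<notin> spectrum_on N T"
  proof (rule r(2))
    have "complex_of_real (e/2 + t) - ?w = complex_of_real t" by simp
    then show "0 < cmod (complex_of_real (e/2 + t) - ?w)" "cmod (complex_of_real (e/2 + t) - ?w) < r"
      using t by (simp_all only: norm_of_real)
  qed
  ultimately show ?thesis by blast
qed

context bounded_operator
begin

text \<open>The Neumann series of the resolvent terminates.\<close>

lemma nilpotent_imp_quasinilpotent:
  assumes N: "complex_vector.subspace N" "T ` N \<subseteq> N" and nil: "nilpotent_on N T"
  shows "quasinilpotent_on N T"
proof -
  obtain n where n: "\<And>x. x \<in> N \<Longrightarrow> (T ^^ n) x = 0" using nil by (auto simp: nilpotent_on_def)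
  have "invertible_on N (\<lambda>x. z *\<^sub>C x - T x)" if z: "z \<noteq> 0" for z
  proof -
    define S where "S x = (\<Sum>k<n. inverse z ^ Suc k *\<^sub>C (T ^^ k) x)" for x
    have blS: "bounded_linear S"
      unfolding S_def
      by (intro bounded_linear_sum bounded_linear_compose[OF bounded_linear_scaleC]
          bounded_operator.bl[OF power])
    interpret S: bounded_linear S by (rule blS)
    have Sc: "S (c *\<^sub>C x) = c *\<^sub>C S x" for c x
      by (simp add: S_def pow_scaleC complex_vector.scale_sum_right scaleC_scaleC mult.commute)
    have SN: "S x \<in> N" if "x \<in> N" for x
      unfolding S_def
      by (intro complex_vector.subspace_sum[OF N(1)] complex_vector.subspace_scale[OF N(1)]
          invariant_pow[OF N(2)] that)
    have tele: "(\<Sum>k<m. inverse z ^ Suc k *\<^sub>C (T ^^ k) (z *\<^sub>C x - T x)) =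
        x - inverse z ^ m *\<^sub>C (T ^^ m) x" for m x
    proof (induction m)
      case (Suc m)
      have "inverse z ^ Suc m *\<^sub>C (T ^^ m) (z *\<^sub>C x - T x) =
          inverse z ^ m *\<^sub>C (T ^^ m) x - inverse z ^ Suc m *\<^sub>C (T ^^ Suc m) x"
        using z by (simp only: pow_diff pow_scaleC pow_T complex_vector.scale_right_diff_distrib
            scaleC_scaleC) simp
      then show ?case by (simp only: sum.lessThan_Suc Suc) simp
    qed simp
    have left: "S (z *\<^sub>C x - T x) = x" if "x \<in> N" for x
      using tele[where m = n and x = x] n[OF that] by (simp add: S_def)
    have comm: "T (S x) = S (T x)" for x
      by (simp only: S_def sum scaleC pow_T) simp
    have right: "z *\<^sub>C S x - T (S x) = x" if "x \<in> N" for x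
      using left[OF that] by (simp add: comm S.diff Sc)
    obtain K where "\<And>x. norm (S x) \<le> norm x * K" using S.bounded by blast
    then have "bounded_op_on N S"
      using SN S.add Sc by (auto simp: bounded_op_on_def)
    then show ?thesis using left right by (auto simp: invertible_on_def)
  qed
  then show ?thesis by (auto simp: quasinilpotent_on_def spectrum_on_def)
qed

text \<open>On \<open>Y = (T ^^ d) ` N\<close> the operator is Kato, and \<open>z - T\<close> is invertible for arbitrarily small \<open>z\<close>;
  hence \<open>T\<close> is bijective on \<open>Y\<close>. Therefore \<open>N\<close> is the direct sum of \<open>Y\<close> and of the kernel of \<open>T ^^ d\<close>
  in \<open>N\<close>, and moving \<open>Y\<close> from the meromorphic to the Saphar part leaves a nilpotent operator.\<close>

theorem Saphar_type_of_meromorphic: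
  assumes st: "kernel_stable T d" and cl: "closed (range (T ^^ d))" "closed (range (T ^^ Suc d))"
    and "generalized_Saphar_meromorphic T"
  shows "Saphar_type T"
proof -
  obtain M N where red: "(M, N) \<in> Red T" and sa: "Saphar_on M T" and mer: "meromorphic_op_on N T"
    using assms(4) by (auto simp: generalized_Saphar_meromorphic_def)
  note R = Red_D[OF red]
  define Y where "Y = (T ^^ d) ` N"
  have YN: "Y = range (T ^^ d) \<inter> N" unfolding Y_def by (rule Red_image_pow[OF red])
  have powY: "(T ^^ k) ` Y = (T ^^ (k + d)) ` N" for k
    by (simp add: Y_def image_comp funpow_add)
  have TY: "T ` Y = range (T ^^ Suc d) \<inter> N"
    using powY[of 1] Red_image_pow[OF red, of "Suc d"] by simp
  have sY: "complex_vector.subspace Y"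
    unfolding YN by (intro complex_vector.subspace_inter subspace_range_pow R)
  have cY: "closed Y" and cTY: "closed (T ` Y)" unfolding YN[symmetric] TY
    using cl R(9) by (auto simp: YN)
  have invY: "T ` Y \<subseteq> Y" unfolding TY using range_pow_mono[of d "Suc d"] by (auto simp: YN)
  have kerY: "ker_on Y T \<subseteq> (T ^^ n) ` Y" for n
  proof
    fix x assume "x \<in> ker_on Y T"
    then have x: "x \<in> ker T \<inter> range (T ^^ d)" "x \<in> N" by (auto simp: YN ker_on_def)
    then have "x \<in> range (T ^^ (n + d)) \<inter> N" using st unfolding kernel_stable_def by blast
    then show "x \<in> (T ^^ n) ` Y" unfolding powY Red_image_pow[OF red] .
  qed
  have stab: "z *\<^sub>C x - T x \<in> N" if "x \<in> N" for z x
    using that R(4) by (auto intro!: complex_vector.subspace_diff[OF R(7)] complex_vector.subspace_scale[OF R(7)])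
  have small: "\<exists>z c. cmod z < e \<and> (\<forall>x\<in>Y. norm x \<le> c * norm (z *\<^sub>C x - T x)) \<and>
      Y \<subseteq> (\<lambda>x. z *\<^sub>C x - T x) ` Y" if e: "e > 0" for e
  proof -
    obtain z where z: "cmod z < e" "z \<notin> spectrum_on N T"
      using meromorphic_small_regular_point[OF mer e] by blast
    from mem_spectrum_on_lower_bound[OF z(2) stab]
    obtain c where c: "\<forall>x\<in>N. norm x \<le> c * norm (z *\<^sub>C x - T x)" and im: "(\<lambda>x. z *\<^sub>C x - T x) ` N = N"
      by blast
    have "Y \<subseteq> (\<lambda>x. z *\<^sub>C x - T x) ` Y"
    proof
      fix y assume "y \<in> Y"
      then obtain n where n: "n \<in> N" "y = (T ^^ d) n" by (auto simp: Y_def)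
      then obtain n' where n': "n' \<in> N" "n = z *\<^sub>C n' - T n'" using im by blast
      have "y = z *\<^sub>C (T ^^ d) n' - T ((T ^^ d) n')"
        by (simp only: n(2) n'(2) pow_diff pow_scaleC pow_T) simp
      then show "y \<in> (\<lambda>x. z *\<^sub>C x - T x) ` Y" using n'(1) by (auto simp: Y_def)
    qed
    then show ?thesis using z(1) c YN by blast
  qed
  have injY: "x = 0" if "x \<in> Y" "T x = 0" for x
  proof (rule ker_trivial_of_small_regular_points[OF sY cY invY cTY kerY _ that])
    fix e :: real assume "e > 0"
    then show "\<exists>z c. cmod z < e \<and> (\<forall>x\<in>Y. norm x \<le> c * norm (z *\<^sub>C x - T x))"
      using small by blast
  qed
  have "Y \<subseteq> T ` Y"
  proof (rule surjective_of_small_regular_points[OF sY cY cTY injY])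
    fix e :: real assume "e > 0"
    then show "\<exists>z. cmod z < e \<and> Y \<subseteq> (\<lambda>x. z *\<^sub>C x - T x) ` Y" using small by blast
  qed
  then have TYY: "T ` Y = Y" using invY by blast
  then have powYY: "(T ^^ k) ` Y = Y" for k
  proof (induction k)
    case (Suc k)
    have "(T ^^ Suc k) ` Y = T ` (T ^^ k) ` Y" by (simp add: image_comp)
    then show ?case using Suc TYY by simp
  qed simp
  have injpow: "x = 0" if "x \<in> Y" "(T ^^ k) x = 0" for x k
    using that
  proof (induction k arbitrary: x)
    case (Suc k)
    then have "T x = 0" using invY Suc.IH[of "T x"] by (auto simp: funpow_swap1)
    then show ?case using injY Suc.prems(1) by blast
  qed simp
  define N' where "N' = N \<inter> ker (T ^^ d)"
  have sN': "complex_vector.subspace N'" unfolding N'_def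
    by (intro complex_vector.subspace_inter subspace_ker_pow R)
  have cN': "closed N'" unfolding N'_def using R(9) bounded_operator.closed_ker_on[OF power, of UNIV] by auto
  have "Y \<inter> N' = {0}"
    using injpow complex_vector.subspace_0[OF sY] complex_vector.subspace_0[OF sN']
    by (auto simp: N'_def ker_on_def)
  moreover have "Y + N' = N"
  proof
    show "Y + N' \<subseteq> N" by (rule plus_subset_csubspace[OF R(7)]) (auto simp: YN N'_def)
    show "N \<subseteq> Y + N'"
    proof
      fix x assume x: "x \<in> N"
      then have "(T ^^ d) x \<in> (T ^^ d) ` Y" unfolding powYY by (simp add: Y_def)
      then obtain y where y: "(T ^^ d) x = (T ^^ d) y" "y \<in> Y" by blast
      then have "x - y \<in> N'"
        using x complex_vector.subspace_diff[OF R(7)] by (auto simp: N'_def ker_on_def YN pow_diff)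
      from set_plus_intro[OF y(2) this] show "x \<in> Y + N'" by simp
    qed
  qed
  ultimately have dN: "direct_sum N Y N'" using sY sN' by (simp add: direct_sum_def)
  define M' where "M' = M + Y"
  have dX: "direct_sum UNIV M' N'"
    using direct_sum_refine(1)[OF direct_sum_commute[OF R(5)] dN] by (simp add: M'_def add.commute)
  have dM': "direct_sum M' M Y"
    using R(5) sY YN complex_vector.subspace_0[OF R(6)] complex_vector.subspace_0[OF sY]
    by (auto simp: direct_sum_def M'_def)
  have closed_plus_Y: "closed_csubspace (A + Y)" if "closed_csubspace A" "A \<subseteq> M" for A
    using that closed_plus_of_direct_sum[OF R(1,2,5), of A Y] csubspace_plus[OF _ sY] cY YN
    by (auto simp: closed_csubspace_def)
  have cM': "closed_csubspace M'" unfolding M'_def by (rule closed_plus_Y[OF R(1)]) simp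
  have MM': "M \<subseteq> M'" using complex_vector.subspace_0[OF sY] by (force simp: M'_def set_plus_def)
  have TM': "T ` M' = T ` M + Y" by (simp add: M'_def image_plus TYY)
  have "T ` M' \<subseteq> M'" unfolding TM' unfolding M'_def by (rule set_plus_mono2[OF R(3)]) simp
  moreover have "T ` N' \<subseteq> N'"
    using R(4) by (auto simp: N'_def ker_on_def pow_T zero)
  ultimately have red': "(M', N') \<in> Red T"
    using cM' sN' cN' dX by (simp add: Red_def closed_csubspace_def)
  have nil: "nilpotent_on N' T" by (auto simp: nilpotent_on_def N'_def ker_on_def)
  have Kato: "\<And>n. ker_on M T \<subseteq> (T ^^ n) ` M" and
    reg: "top_complemented_in M (ker_on M T)" "top_complemented_in M (T ` M)"
    using sa by (auto simp: Saphar_on_def Kato_on_def relatively_regular_on_def)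
  have ker': "ker_on M' T = ker_on M T"
  proof
    show "ker_on M T \<subseteq> ker_on M' T" using MM' by (auto simp: ker_on_def)
    show "ker_on M' T \<subseteq> ker_on M T"
    proof
      fix x assume x: "x \<in> ker_on M' T"
      then obtain m y where my: "x = m + y" "m \<in> M" "y \<in> Y"
        by (auto simp: ker_on_def M'_def elim!: set_plus_elim)
      have "(T ^^ 1) (m + y) = 0" using x my by (simp add: ker_on_def)
      from Red_pow_eq_0[OF red my(2) _ this] have "T m = 0" "T y = 0" using my(3) YN by auto
      then have "y = 0" using injY my(3) by blast
      then show "x \<in> ker_on M T" using my \<open>T m = 0\<close> by (simp add: ker_on_def)
    qed
  qed
  obtain W where W: "closed_csubspace (ker_on M T)" "closed_csubspace W" "direct_sum M (ker_on M T) W"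
    using reg(1) by (auto simp: top_complemented_in_def)
  obtain W' where W': "closed_csubspace (T ` M)" "closed_csubspace W'" "direct_sum M (T ` M) W'"
    using reg(2) by (auto simp: top_complemented_in_def)
  have "W \<subseteq> M" by (rule direct_sum_right_subset[OF W(3)])
  then have "top_complemented_in M' (ker_on M' T)"
    unfolding top_complemented_in_def ker'
    using W(1) closed_plus_Y[OF W(2)] direct_sum_refine(2)[OF dM' W(3)] by blast
  moreover have cTM': "closed_csubspace (T ` M')"
    unfolding TM' by (rule closed_plus_Y[OF W'(1) R(3)])
  then have "top_complemented_in M' (T ` M')"
    using W'(2) direct_sum_refine(1)[OF dM' W'(3)] unfolding top_complemented_in_def TM' by blast
  moreover have "ker_on M' T \<subseteq> (T ^^ n) ` M'" for n
    unfolding ker' using Kato[of n] MM' by blast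
  ultimately have "Saphar_on M' T"
    using cTM' by (simp add: Saphar_on_def Kato_on_def relatively_regular_on_def closed_csubspace_def)
  then show ?thesis using red' nil by (auto simp: Saphar_type_def)
qed

section \<open>The equivalences for an operator with stable kernel\<close>

lemma generalized_Saphar_of_Saphar_type: "Saphar_type T \<Longrightarrow> generalized_Saphar T"
  using nilpotent_imp_quasinilpotent Red_D(4,7)
  unfolding Saphar_type_def generalized_Saphar_def by blast

lemma generalized_Saphar_imp_meromorphic: "generalized_Saphar T \<Longrightarrow> generalized_Saphar_meromorphic T"
  unfolding generalized_Saphar_def generalized_Saphar_meromorphic_def quasinilpotent_on_def
    meromorphic_op_on_def by blast

theorem Saphar_equivalences:
  assumes st: "kernel_stable T d" and cl: "\<And>n. n \<ge> d \<Longrightarrow> closed (range (T ^^ n))"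
  shows "top_complemented_in UNIV (ker T \<inter> range (T ^^ d)) \<and>
      top_complemented_in UNIV (range T + ker (T ^^ d)) \<longleftrightarrow> Saphar_type T"
    and "Saphar_type T \<longleftrightarrow> generalized_Saphar T"
    and "generalized_Saphar T \<longleftrightarrow> generalized_Saphar_meromorphic T"
proof -
  show "top_complemented_in UNIV (ker T \<inter> range (T ^^ d)) \<and>
      top_complemented_in UNIV (range T + ker (T ^^ d)) \<longleftrightarrow> Saphar_type T"
    using Saphar_type_of_complemented[OF st cl[OF order.refl]] complemented_of_Saphar_type[OF st]
    by blast
  have "closed (range (T ^^ Suc d))" by (rule cl) simp
  from Saphar_type_of_meromorphic[OF st cl[OF order.refl] this]
  show "Saphar_type T \<longleftrightarrow> generalized_Saphar T"
    "generalized_Saphar T \<longleftrightarrow> generalized_Saphar_meromorphic T"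
    using generalized_Saphar_of_Saphar_type generalized_Saphar_imp_meromorphic by blast+
qed

end

section \<open>Ascent, descent and the degree of stable iteration\<close>

lemma Inf_enat_image: "S \<noteq> {} \<Longrightarrow> Inf (enat ` S) = enat (LEAST n. n \<in> S)"
proof (rule antisym)
  assume "S \<noteq> {}"
  then have "(LEAST n. n \<in> S) \<in> S" by (auto intro: LeastI)
  then show "Inf (enat ` S) \<le> enat (LEAST n. n \<in> S)" by (intro Inf_lower) auto
  show "enat (LEAST n. n \<in> S) \<le> Inf (enat ` S)" by (rule Inf_greatest) (auto intro: Least_le)
qed

lemma Inf_enat_finiteE:
  assumes "Inf (enat ` S) < \<infinity>"
  obtains n where "n \<in> S" "Inf (enat ` S) = enat n"
proof -
  have "S \<noteq> {}" using assms by (auto simp: top_enat_def)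
  then have "(LEAST n. n \<in> S) \<in> S" by (auto intro: LeastI)
  then show thesis using that Inf_enat_image[OF \<open>S \<noteq> {}\<close>] by blast
qed

lemma finite_cdim_subspace:
  assumes "finite_cdim V" "A \<subseteq> V" "complex_vector.subspace A"
  shows "finite_cdim A"
proof -
  obtain B where B: "finite B" "complex_vector.span B = V" using assms(1) by (auto simp: finite_cdim_def)
  obtain C where C: "C \<subseteq> A" "complex_vector.independent C" "A \<subseteq> complex_vector.span C"
    using complex_vector.basis_exists[of A] by metis
  have "finite C" using complex_vector.independent_span_bound[OF B(1) C(2)] C(1) assms(2) B(2) by auto
  moreover have "complex_vector.span C = A"
    using C(1,3) complex_vector.span_minimal[OF C(1) assms(3)] by blast
  ultimately show ?thesis by (auto simp: finite_cdim_def)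
qed

lemma finite_cdim_subspace_eqI:
  assumes V: "finite_cdim V" and A: "A \<subseteq> V" "complex_vector.subspace A"
    and dim: "complex_vector.dim V \<le> complex_vector.dim A"
  shows "A = V"
proof -
  obtain B where B: "finite B" "complex_vector.span B = V" using V by (auto simp: finite_cdim_def)
  obtain C where C: "C \<subseteq> A" "complex_vector.independent C" "A \<subseteq> complex_vector.span C"
    "card C = complex_vector.dim A"
    using complex_vector.basis_exists[of A] by metis
  obtain D where D: "C \<subseteq> D" "D \<subseteq> V" "complex_vector.independent D" "V \<subseteq> complex_vector.span D"
    using complex_vector.maximal_independent_subset_extend[OF order.trans[OF C(1) A(1)] C(2)] by metis
  have "finite D" using complex_vector.independent_span_bound[OF B(1) D(3)] D(2) B(2) by auto
  moreover have "card D = complex_vector.dim V" using complex_vector.basis_card_eq_dim D by blast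
  ultimately have "C = D" using D(1) C(4) dim by (intro card_seteq) auto
  then have "V \<subseteq> A" using D(4) complex_vector.span_minimal[OF C(1) A(2)] by blast
  then show ?thesis using A(1) by blast
qed

context bounded_operator
begin

lemma dis_eq: "dis T = Inf (enat ` Collect (kernel_stable T))"
proof -
  have "(\<forall>m\<ge>n. m \<ge> 1 \<longrightarrow> ker T \<inter> range (T ^^ n) = ker T \<inter> range (T ^^ m)) \<longleftrightarrow> kernel_stable T n" for n
  proof
    assume *: "\<forall>m\<ge>n. m \<ge> 1 \<longrightarrow> ker T \<inter> range (T ^^ n) = ker T \<inter> range (T ^^ m)"
    have "ker T \<inter> range (T ^^ n) \<subseteq> range (T ^^ m)" for m
    proof (cases "m \<le> n")
      case True
      then show ?thesis using range_pow_mono by blast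
    next
      case False
      then have "ker T \<inter> range (T ^^ n) = ker T \<inter> range (T ^^ m)" using * by simp
      then show ?thesis by blast
    qed
    then show "kernel_stable T n" by (simp add: kernel_stable_def)
  next
    assume "kernel_stable T n"
    then show "\<forall>m\<ge>n. m \<ge> 1 \<longrightarrow> ker T \<inter> range (T ^^ n) = ker T \<inter> range (T ^^ m)"
      using range_pow_mono unfolding kernel_stable_def by blast
  qed
  then show ?thesis by (simp add: dis_def)
qed

lemma subspace_ker_range: "complex_vector.subspace (ker T \<inter> range (T ^^ n))"
  by (intro complex_vector.subspace_inter subspace_ker_on subspace_range_pow) simp

lemma subspace_range_ker: "complex_vector.subspace (range T + ker (T ^^ n))"
  by (intro csubspace_plus subspace_image subspace_ker_pow) simp

text \<open>The decreasing finite-dimensional spaces \<open>ker T \<inter> range (T ^^ n)\<close>, \<open>n \<ge> a\<close>, are constant from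
  the point on where the dimension is least.\<close>

lemma kernel_stable_of_ess_ascent:
  assumes fin: "finite_cdim (ker T \<inter> range (T ^^ a))"
  shows "\<exists>d. kernel_stable T d"
proof -
  let ?K = "\<lambda>n. ker T \<inter> range (T ^^ n)"
  obtain m where m: "m \<ge> a" "\<And>n. n \<ge> a \<Longrightarrow> complex_vector.dim (?K m) \<le> complex_vector.dim (?K n)"
    using ex_has_least_nat[of "\<lambda>n. n \<ge> a" a "\<lambda>n. complex_vector.dim (?K n)"] by blast
  have fm: "finite_cdim (?K m)"
    using range_pow_mono[OF m(1)] by (intro finite_cdim_subspace[OF fin] subspace_ker_range) blast
  have "?K m \<subseteq> range (T ^^ n)" for n
  proof (cases "n \<le> m")
    case True
    then show ?thesis using range_pow_mono by blast
  next
    case False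
    then have "?K n = ?K m"
      using range_pow_mono[of m n] m by (intro finite_cdim_subspace_eqI[OF fm] subspace_ker_range) auto
    then show ?thesis by blast
  qed
  then have "kernel_stable T m" unfolding kernel_stable_def by blast
  then show ?thesis by blast
qed

text \<open>Among all supplements of the spaces \<open>range T + ker (T ^^ n)\<close> choose a spanning set \<open>B\<close> of least
  cardinality, occurring for \<open>n = m\<close>. For \<open>n \<ge> m\<close> it is still a minimal supplement, hence
  independent of the larger space, so the spaces are equal from \<open>m\<close> on. If
  \<open>x = (T ^^ n) y\<close> lies in the kernel of \<open>T\<close>, then \<open>y \<in> ker (T ^^ Suc n)\<close>, so this equality puts \<open>y\<close> into
  \<open>range T + ker (T ^^ n)\<close> and \<open>x\<close> into the next range.\<close>

lemma kernel_stable_of_ess_descent: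
  assumes fin: "finite_ccodim (range T + ker (T ^^ a))"
  shows "\<exists>d. kernel_stable T d"
proof -
  let ?S = "\<lambda>n. range T + ker (T ^^ n)"
  let ?Q = "\<lambda>(m, B). finite B \<and> ?S m + complex_vector.span B = UNIV"
  obtain B0 where "?Q (a, B0)" using fin by (auto simp: finite_ccodim_def)
  from ex_has_least_nat[of ?Q, OF this, of "\<lambda>(m, B). card B"]
  obtain m B where B: "finite B" "?S m + complex_vector.span B = UNIV"
    and min: "\<And>n B'. finite B' \<Longrightarrow> ?S n + complex_vector.span B' = UNIV \<Longrightarrow> card B \<le> card B'"
    by auto
  have mono: "?S m \<subseteq> ?S n" if "m \<le> n" for n
    by (rule set_plus_mono2[OF order.refl ker_pow_mono[OF that]])
  have const: "?S n = ?S m" if "m \<le> n" for n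
  proof
    have "?S m + complex_vector.span B \<subseteq> ?S n + complex_vector.span B"
      by (rule set_plus_mono2[OF mono[OF that] order.refl])
    then have "?S n + complex_vector.span B = UNIV" unfolding B(2) by (rule top_le)
    then have disj: "?S n \<inter> complex_vector.span B = {0}"
      by (rule minimal_supplement_disjoint[OF subspace_range_ker B(1)]) (rule min; assumption)
    show "?S n \<subseteq> ?S m"
    proof
      fix x assume x: "x \<in> ?S n"
      have "x \<in> ?S m + complex_vector.span B" using B(2) by simp
      then obtain l s where ls: "x = l + s" "l \<in> ?S m" "s \<in> complex_vector.span B" by (rule set_plus_elim)
      have "x - l \<in> ?S n"
        using complex_vector.subspace_diff[OF subspace_range_ker x] mono[OF that] ls(2) by blast
      then have "s = 0" using disj ls by auto
      then show "x \<in> ?S m" using ls by simp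
    qed
  qed (rule mono[OF that])
  have step: "x \<in> range (T ^^ Suc n)" if n: "m \<le> n" and x: "x \<in> ker T" "x \<in> range (T ^^ n)" for x n
  proof -
    obtain y where y: "x = (T ^^ n) y" using x(2) by auto
    have "y \<in> ker (T ^^ Suc n)" using x(1) by (simp add: y ker_on_def)
    then have "T 0 + y \<in> ?S (Suc n)" by (rule set_plus_intro[OF rangeI])
    then have "y \<in> ?S n" using const[of n] const[of "Suc n"] n by (simp add: zero)
    then show ?thesis unfolding range_plus_ker_pow y by simp
  qed
  have "x \<in> range (T ^^ n)" if "x \<in> ker T" "x \<in> range (T ^^ m)" for x n
  proof (cases "n \<le> m")
    case True
    then show ?thesis using range_pow_mono that by blast
  next
    case False
    then have "m \<le> n" by simp
    then show ?thesis
      by (induction rule: dec_induct) (use that step in auto)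
  qed
  then have "kernel_stable T m" unfolding kernel_stable_def by blast
  then show ?thesis by blast
qed

lemma finite_cdim_of_kernel_stable:
  assumes "kernel_stable T d" "finite_cdim (ker T \<inter> range (T ^^ a))"
  shows "finite_cdim (ker T \<inter> range (T ^^ d))"
  using assms(1) by (intro finite_cdim_subspace[OF assms(2)] subspace_ker_range)
    (auto simp: kernel_stable_def)

text \<open>Stability makes \<open>range T + ker (T ^^ d)\<close> the largest of these spaces: if \<open>(T ^^ a) x = 0\<close>, then
  \<open>(T ^^ d) x\<close> is annihilated by a power of \<open>T\<close> and therefore lies in \<open>range (T ^^ Suc d)\<close>.\<close>

lemma finite_ccodim_of_kernel_stable:
  assumes st: "kernel_stable T d" and "finite_ccodim (range T + ker (T ^^ a))"
  shows "finite_ccodim (range T + ker (T ^^ d))"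
proof -
  obtain B where B: "finite B" "range T + ker (T ^^ a) + complex_vector.span B = UNIV"
    using assms(2) by (auto simp: finite_ccodim_def)
  have "ker (T ^^ a) \<subseteq> range T + ker (T ^^ d)"
  proof
    fix x assume x: "x \<in> ker (T ^^ a)"
    have "(T ^^ a) ((T ^^ d) x) = (T ^^ d) ((T ^^ a) x)" by (simp only: pow_pow add.commute)
    then have "(T ^^ a) ((T ^^ d) x) = 0" using x by (simp add: ker_on_def pow_zero)
    from kernel_stable_pow[OF st rangeI this] show "x \<in> range T + ker (T ^^ d)"
      unfolding range_plus_ker_pow by blast
  qed
  moreover have "range T \<subseteq> range T + ker (T ^^ d)"
    using complex_vector.subspace_0[OF subspace_ker_pow] by (force simp: set_plus_def)
  ultimately have "range T + ker (T ^^ a) \<subseteq> range T + ker (T ^^ d)"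
    by (intro plus_subset_csubspace subspace_range_ker)
  then have "range T + ker (T ^^ a) + complex_vector.span B \<subseteq>
      range T + ker (T ^^ d) + complex_vector.span B"
    by (rule set_plus_mono2) simp
  then have "range T + ker (T ^^ d) + complex_vector.span B = UNIV" unfolding B(2) by (rule top_le)
  then show ?thesis using B(1) by (auto simp: finite_ccodim_def)
qed

text \<open>With \<open>p\<close> the ascent, \<open>ker T \<inter> range (T ^^ p)\<close> is zero, so one of the two complements exists
  trivially.\<close>

theorem upper_Drazin_equivalences:
  assumes "upper_Drazin T"
  shows "(left_Drazin T \<longleftrightarrow> Saphar_type T) \<and> (Saphar_type T \<longleftrightarrow> generalized_Saphar T) \<and>
    (generalized_Saphar T \<longleftrightarrow> generalized_Saphar_meromorphic T)"
proof -
  from assms obtain p where p: "ker (T ^^ p) = ker (T ^^ (p + 1))" "ascent T = enat p"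
    and cl: "\<And>n. n \<ge> p \<Longrightarrow> closed (range (T ^^ n))"
    unfolding upper_Drazin_def ascent_def by (elim conjE Inf_enat_finiteE) auto
  have K: "ker T \<inter> range (T ^^ p) = {0}"
  proof -
    have "x = 0" if x: "x \<in> ker T" "x \<in> range (T ^^ p)" for x
    proof -
      obtain y where y: "x = (T ^^ p) y" using x(2) by auto
      then have "y \<in> ker (T ^^ (p + 1))" using x(1) by (simp add: ker_on_def)
      then have "y \<in> ker (T ^^ p)" using p(1) by simp
      then show ?thesis by (simp add: y ker_on_def)
    qed
    then show ?thesis using complex_vector.subspace_0[OF subspace_ker_range[of p]] by blast
  qed
  then have st: "kernel_stable T p"
    using complex_vector.subspace_0[OF subspace_range_pow] by (simp add: kernel_stable_def)
  have "finite_cdim (ker T \<inter> range (T ^^ p))"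
    unfolding K finite_cdim_def by (intro exI[of _ "{}"]) simp
  then have "top_complemented_in UNIV (ker T \<inter> range (T ^^ p))" by (rule finite_cdim_complemented)
  then show ?thesis using Saphar_equivalences[OF st cl] p(2) by (simp add: left_Drazin_def)
qed

text \<open>With \<open>q\<close> the descent, \<open>range T + ker (T ^^ q)\<close> is the whole space.\<close>

theorem lower_Drazin_equivalences:
  assumes "lower_Drazin T"
  shows "(right_Drazin T \<longleftrightarrow> Saphar_type T) \<and> (Saphar_type T \<longleftrightarrow> generalized_Saphar T) \<and>
    (generalized_Saphar T \<longleftrightarrow> generalized_Saphar_meromorphic T)"
proof -
  from assms obtain q where q: "range (T ^^ q) = range (T ^^ (q + 1))" "descent T = enat q"
    and cl: "\<And>n. n \<ge> q \<Longrightarrow> closed (range (T ^^ n))"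
    unfolding lower_Drazin_def descent_def by (elim conjE Inf_enat_finiteE) auto
  have im: "T ` range (T ^^ n) = range (T ^^ Suc n)" for n by (auto simp: image_image)
  have const: "range (T ^^ n) = range (T ^^ q)" if "q \<le> n" for n
    using that
  proof (induction rule: dec_induct)
    case (step n)
    then show ?case using im[of n] im[of q] q(1) by simp
  qed simp
  have st: "kernel_stable T q"
    unfolding kernel_stable_def
  proof
    fix m
    show "ker T \<inter> range (T ^^ q) \<subseteq> range (T ^^ m)"
      using range_pow_mono[of m q] const[of m] by (cases "m \<le> q") auto
  qed
  have "range T + ker (T ^^ q) = UNIV" unfolding range_plus_ker_pow using q(1) by auto
  moreover have "top_complemented_in UNIV (UNIV :: 'a set)"
    unfolding top_complemented_in_def
    by (intro conjI exI[of _ "{0}"]) (auto simp: closed_csubspace_def direct_sum_def set_plus_def)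
  ultimately show ?thesis using Saphar_equivalences[OF st cl] q(2) by (simp add: right_Drazin_def)
qed

text \<open>The complement of \<open>ker T \<inter> range (T ^^ d)\<close> exists by the Hahn--Banach theorem, as the space is
  finite-dimensional.\<close>

theorem ess_upper_Drazin_equivalences:
  assumes "ess_upper_Drazin T"
  shows "(ess_left_Drazin T \<longleftrightarrow> Saphar_type T) \<and> (Saphar_type T \<longleftrightarrow> generalized_Saphar T) \<and>
    (generalized_Saphar T \<longleftrightarrow> generalized_Saphar_meromorphic T)"
proof -
  from assms obtain a where a: "finite_cdim (ker T \<inter> range (T ^^ a))" and fin: "ess_ascent T < \<infinity>"
    and cl: "\<And>n. enat n \<ge> ess_ascent T \<Longrightarrow> closed (range (T ^^ n))"
    unfolding ess_upper_Drazin_def ess_ascent_def by (elim conjE Inf_enat_finiteE) auto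
  have "dis T < \<infinity>"
    using kernel_stable_of_ess_ascent[OF a] Inf_enat_image[of "Collect (kernel_stable T)"]
    unfolding dis_eq by auto
  then obtain d where d: "dis T = enat d" and st: "kernel_stable T d"
    unfolding dis_eq by (elim Inf_enat_finiteE) auto
  have K: "finite_cdim (ker T \<inter> range (T ^^ d))" by (rule finite_cdim_of_kernel_stable[OF st a])
  then have le: "ess_ascent T \<le> enat d" unfolding ess_ascent_def by (intro Inf_lower) auto
  then have cl: "closed (range (T ^^ n))" if "n \<ge> d" for n
    using that by (intro cl order.trans[OF le]) simp
  show ?thesis using Saphar_equivalences[OF st cl] finite_cdim_complemented[OF K] d fin
    by (simp add: ess_left_Drazin_def)
qed

text \<open>The space \<open>range T + ker (T ^^ d)\<close> is closed, as a preimage of \<open>range (T ^^ Suc d)\<close>, and has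
  finite codimension.\<close>

theorem ess_lower_Drazin_equivalences:
  assumes "ess_lower_Drazin T"
  shows "(ess_right_Drazin T \<longleftrightarrow> Saphar_type T) \<and> (Saphar_type T \<longleftrightarrow> generalized_Saphar T) \<and>
    (generalized_Saphar T \<longleftrightarrow> generalized_Saphar_meromorphic T)"
proof -
  from assms obtain a where a: "finite_ccodim (range T + ker (T ^^ a))" and fin: "ess_descent T < \<infinity>"
    and cl: "\<And>n. enat n \<ge> ess_descent T \<Longrightarrow> closed (range (T ^^ n))"
    unfolding ess_lower_Drazin_def ess_descent_def by (elim conjE Inf_enat_finiteE) auto
  have "dis T < \<infinity>"
    using kernel_stable_of_ess_descent[OF a] Inf_enat_image[of "Collect (kernel_stable T)"]
    unfolding dis_eq by auto
  then obtain d where d: "dis T = enat d" and st: "kernel_stable T d"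
    unfolding dis_eq by (elim Inf_enat_finiteE) auto
  have S: "finite_ccodim (range T + ker (T ^^ d))" by (rule finite_ccodim_of_kernel_stable[OF st a])
  then have le: "ess_descent T \<le> enat d" unfolding ess_descent_def by (intro Inf_lower) auto
  then have cl: "closed (range (T ^^ n))" if "n \<ge> d" for n
    using that by (intro cl order.trans[OF le]) simp
  have "closed (range T + ker (T ^^ d))"
    unfolding range_plus_ker_pow by (intro bounded_operator.closed_vimage[OF power] cl) simp
  then have "closed_csubspace (range T + ker (T ^^ d))"
    using subspace_range_ker by (simp add: closed_csubspace_def)
  from finite_ccodim_complemented[OF this S] show ?thesis
    using Saphar_equivalences[OF st cl] d fin by (simp add: ess_right_Drazin_def)
qed

end

theorem theorem3p1:
  fixes T :: "'a::complex_banach \<Rightarrow> 'a"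
  assumes "\<not> finite_cdim (UNIV :: 'a set)"
    and "bounded_op_on UNIV T"
  shows
    "(upper_Drazin T \<longrightarrow>
        (left_Drazin T \<longleftrightarrow> Saphar_type T) \<and>
        (Saphar_type T \<longleftrightarrow> generalized_Saphar T) \<and>
        (generalized_Saphar T \<longleftrightarrow> generalized_Saphar_meromorphic T)) \<and>
     (lower_Drazin T \<longrightarrow>
        (right_Drazin T \<longleftrightarrow> Saphar_type T) \<and>
        (Saphar_type T \<longleftrightarrow> generalized_Saphar T) \<and>
        (generalized_Saphar T \<longleftrightarrow> generalized_Saphar_meromorphic T)) \<and>
     (ess_upper_Drazin T \<longrightarrow>
        (ess_left_Drazin T \<longleftrightarrow> Saphar_type T) \<and>
        (Saphar_type T \<longleftrightarrow> generalized_Saphar T) \<and>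
        (generalized_Saphar T \<longleftrightarrow> generalized_Saphar_meromorphic T)) \<and>
     (ess_lower_Drazin T \<longrightarrow>
        (ess_right_Drazin T \<longleftrightarrow> Saphar_type T) \<and>
        (Saphar_type T \<longleftrightarrow> generalized_Saphar T) \<and>
        (generalized_Saphar T \<longleftrightarrow> generalized_Saphar_meromorphic T))"
proof -
  interpret bounded_operator T by unfold_locales (rule assms(2))
  show ?thesis
    using upper_Drazin_equivalences lower_Drazin_equivalences
      ess_upper_Drazin_equivalences ess_lower_Drazin_equivalences
    by blast
qed

end
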